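(* Let $k\ge 3$ be an integer and let $P$ be a factor of $W^{(k)}$ of length at least $2$. Then $P$ is a maximal palindromic factor of $W^{(k)}$ if and only if $P\in P^{(k)}_1\cup P^{(k)}_2\cup P^{(k)}_3\cup P^{(k)}_4$, where $P^{(k)}_1=\{ki\oplus (W^{(k)}_n n^{-1}) : 2\le n\le k-1,\ i\ge 0\}$; $P^{(k)}_2=\{ki\oplus (Z_{n,j}^R\, j\, Z_{n,j}) : k\le n\le 2k-3,\ n-k+2\le j\le k-1,\ i\ge 0\}$ with $Z_{n,j}=W^{(k)}_{j-1}W^{(k)}_{j-2}\cdots W^{(k)}_{n-k+1}$; $P^{(k)}_3=\{ki\oplus (W^{(k)}_m W^{(k)}_m m^{-1}),\ ki\oplus (W^{(k)}_m W^{(k)}_m W^{(k)}_m m^{-1}) : m=n-2k+1,\ 2k\le n\le 3k-3,\ i\ge 1\}$; $P^{(k)}_4=\{ki\oplus (W^{(k)}_{k-1}W^{(k)}_{k-1}(k-1)^{-1}),\ ki\oplus (0^{-1}W^{(k)}_{k-1}W^{(k)}_{k-1}W^{(k)}_{k-1}(0\,(k-1))^{-1}),\ ki\oplus(00) : i\ge 1\}$.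
   Context: The alphabet is $\mathbb{N}=\{0,1,2,\dots\}$. For an integer $k\ge 3$, $\varphi_k$ is the morphism of $\mathbb{N}^*$ defined on letters, for $i\ge 0$ and $0\le j\le k-1$, by $\varphi_k(ki+j)=(ki)(ki+j+1)$ (two letters) if $0\le j\le k-2$, and $\varphi_k(ki+k-1)=(ki+k)$ (one letter). For $n\ge 0$, $W^{(k)}_n=\varphi_k^n(0)$, and $W^{(k)}=\varphi_k^{\omega}(0)$ is the infinite word having every $W^{(k)}_n$ as a prefix. For a finite word $W$ and integer $m$, $m\oplus W$ is the word obtained by adding $m$ to each letter of $W$. Juxtaposition of words is concatenation; $W^R$ is the reversal of $W$; a palindrome is a word equal to its reversal. For a word $W$ ending with the word $U$, $WU^{-1}$ denotes $W$ with that suffix $U$ deleted; for $W$ beginning with $U$, $U^{-1}W$ denotes $W$ with that prefix deleted; here $0\,(k-1)$ is the two-letter word with letters $0$ and $k-1$. Writing $W^{(k)}=w_1w_2w_3\cdots$ and $W^{(k)}[s,t]=w_s\cdots w_t$, a word $P$ with $|P|\ge 2$ is a maximal palindromic factor of $W^{(k)}$ if $P$ is a palindrome and for some $s\ge1$ we have $W^{(k)}[s,s+|P|-1]=P$ and there is no palindrome $W^{(k)}[s',t']$ with $s'+t'=2s+|P|-1$ and $t'-s'>|P|-1$ (i.e. no longer palindromic factor with the same center position). Only palindromes of length at least $2$ are considered. *)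

theory Defs
  imports Main "HOL-Library.Sublist"
begin

text \<open>Finite words over the alphabet of natural numbers are lists.  An infinite word is a
  function \<open>w :: nat \<Rightarrow> 'a\<close> whose first letter is \<open>w 0\<close>.\<close>

text \<open>Every letter is uniquely \<open>k * i + j\<close> with \<open>j < k\<close>; here \<open>i = a div k\<close> and \<open>j = a mod k\<close>.\<close>

definition phi_letter :: "nat \<Rightarrow> nat \<Rightarrow> nat list" where
  "phi_letter k a = (if a mod k \<le> k - 2 then [k * (a div k), a + 1] else [a + 1])"

lemma phi_letter_low:
  assumes "k \<ge> 3" "j \<le> k - 2"
  shows "phi_letter k (k * i + j) = [k * i, k * i + j + 1]"
  using assms by (simp add: phi_letter_def)

lemma phi_letter_high:
  assumes "k \<ge> 3"
  shows "phi_letter k (k * i + (k - 1)) = [k * i + k]"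
proof -
  have "(k * i + j) mod k = j" if "j < k" for j
    using that by simp
  from this[of "k - 1"] have "(k * i + (k - 1)) mod k = k - 1"
    using assms by linarith
  then show ?thesis
    using assms by (auto simp: phi_letter_def)
qed

definition phi :: "nat \<Rightarrow> nat list \<Rightarrow> nat list" where
  "phi k w = concat (map (phi_letter k) w)"

definition W :: "nat \<Rightarrow> nat \<Rightarrow> nat list" where
  "W k n = (phi k ^^ n) [0]"

definition W_inf :: "nat \<Rightarrow> nat \<Rightarrow> nat" where
  "W_inf k = (THE w. \<forall>n. \<forall>r < length (W k n). w r = W k n ! r)"

text \<open>\<open>subword w s t\<close> is the word \<open>w[s,t]\<close> of the letters at positions \<open>s, \<dots>, t\<close>, where positions
  are counted from 1.\<close>

definition subword :: "(nat \<Rightarrow> 'a) \<Rightarrow> nat \<Rightarrow> nat \<Rightarrow> 'a list" where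
  "subword w s t = map (\<lambda>r. w (r - 1)) [s..<Suc t]"

definition is_factor :: "(nat \<Rightarrow> 'a) \<Rightarrow> 'a list \<Rightarrow> bool" where
  "is_factor w P \<longleftrightarrow> (\<exists>s t. 1 \<le> s \<and> P = subword w s t)"

definition palindrome :: "'a list \<Rightarrow> bool" where
  "palindrome P \<longleftrightarrow> rev P = P"

definition maximal_palindromic_factor :: "(nat \<Rightarrow> 'a) \<Rightarrow> 'a list \<Rightarrow> bool" where
  "maximal_palindromic_factor w P \<longleftrightarrow>
     2 \<le> length P \<and> palindrome P \<and>
     (\<exists>s\<ge>1. subword w s (s + length P - 1) = P \<and>
        \<not> (\<exists>s' t'. 1 \<le> s' \<and> s' \<le> t' \<and> s' + t' = 2 * s + length P - 1 \<and>
              t' - s' > length P - 1 \<and> palindrome (subword w s' t')))"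

definition shift :: "nat \<Rightarrow> nat list \<Rightarrow> nat list" where
  "shift m w = map (\<lambda>a. m + a) w"

text \<open>\<open>del_suffix w u\<close> and \<open>del_prefix u w\<close> are meaningful only if \<open>u\<close> is a suffix, respectively
  a prefix, of \<open>w\<close>; the lemmas at the end of this theory show that this is so wherever the
  operations are used.\<close>

definition del_suffix :: "'a list \<Rightarrow> 'a list \<Rightarrow> 'a list" where
  "del_suffix w u = take (length w - length u) w"

definition del_prefix :: "'a list \<Rightarrow> 'a list \<Rightarrow> 'a list" where
  "del_prefix u w = drop (length u) w"

lemma del_suffix_append: "del_suffix (v @ u) u = v"
  by (simp add: del_suffix_def)

lemma del_prefix_append: "del_prefix u (u @ v) = v"
  by (simp add: del_prefix_def)

text \<open>The factors of \<open>Z\<close> have descending indices \<open>j - 1, j - 2, \<dots>, n - k + 1\<close>.\<close>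

definition Z :: "nat \<Rightarrow> nat \<Rightarrow> nat \<Rightarrow> nat list" where
  "Z k n j = concat (map (W k) (rev [n - k + 1..<j]))"

definition P1 :: "nat \<Rightarrow> nat list set" where
  "P1 k = {shift (k * i) (del_suffix (W k n) [n]) | n i. 2 \<le> n \<and> n \<le> k - 1}"

definition P2 :: "nat \<Rightarrow> nat list set" where
  "P2 k = {shift (k * i) (rev (Z k n j) @ [j] @ Z k n j) | n j i.
             k \<le> n \<and> n \<le> 2 * k - 3 \<and> n - k + 2 \<le> j \<and> j \<le> k - 1}"

definition P3 :: "nat \<Rightarrow> nat list set" where
  "P3 k =
     {shift (k * i) (del_suffix (W k m @ W k m) [m]) | m n i.
        m = n - 2 * k + 1 \<and> 2 * k \<le> n \<and> n \<le> 3 * k - 3 \<and> 1 \<le> i} \<union>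
     {shift (k * i) (del_suffix (W k m @ W k m @ W k m) [m]) | m n i.
        m = n - 2 * k + 1 \<and> 2 * k \<le> n \<and> n \<le> 3 * k - 3 \<and> 1 \<le> i}"

definition P4 :: "nat \<Rightarrow> nat list set" where
  "P4 k =
     {shift (k * i) (del_suffix (W k (k - 1) @ W k (k - 1)) [k - 1]) | i. 1 \<le> i} \<union>
     {shift (k * i)
        (del_prefix [0] (del_suffix (W k (k - 1) @ W k (k - 1) @ W k (k - 1)) [0, k - 1])) | i.
        1 \<le> i} \<union>
     {shift (k * i) [0, 0] | i. 1 \<le> i}"

text \<open>Well-definedness of the infinite word and of the deletions.\<close>

lemma phi_append: "phi k (u @ v) = phi k u @ phi k v"
  by (simp add: phi_def)

lemma W_0: "W k 0 = [0]"
  by (simp add: W_def)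

lemma W_Suc: "W k (Suc n) = phi k (W k n)"
  by (simp add: W_def)

lemma length_phi: "length w \<le> length (phi k w)"
  by (induction w) (auto simp: phi_def phi_letter_def)

lemma W_starts: "\<exists>u. W k n = 0 # u \<and> n \<le> length u"
proof (induction n)
  case 0
  then show ?case by (simp add: W_0)
next
  case (Suc n)
  then obtain u where u: "W k n = 0 # u" "n \<le> length u" by blast
  have "phi k (0 # u) = 0 # 1 # phi k u"
    by (simp add: phi_def phi_letter_def)
  then show ?case
    using u length_phi[of u k] by (auto simp: W_Suc)
qed

lemma prefix_W_Suc: "prefix (W k n) (W k (Suc n))"
proof (induction n)
  case 0
  then show ?case by (simp add: W_0 W_Suc phi_def phi_letter_def)
next
  case (Suc n)
  then show ?case
    by (metis W_Suc phi_append prefix_def)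
qed

lemma prefix_W: "m \<le> n \<Longrightarrow> prefix (W k m) (W k n)"
  by (induction rule: dec_induct) (auto intro: prefix_order.trans prefix_W_Suc)

lemma length_W_gt: "n < length (W k n)"
  using W_starts[of k n] by auto

lemma W_nth_eq:
  assumes "r < length (W k m)" "r < length (W k n)"
  shows "W k m ! r = W k n ! r"
proof (cases "m \<le> n")
  case True
  then show ?thesis
    using assms prefix_W[of m n k] by (auto simp: prefix_def nth_append)
next
  case False
  then show ?thesis
    using assms prefix_W[of n m k] by (auto simp: prefix_def nth_append)
qed

lemma W_inf_ex1: "\<exists>!w. \<forall>n. \<forall>r < length (W k n). w r = W k n ! r"
proof
  show "\<forall>n. \<forall>r < length (W k n). W k r ! r = W k n ! r"
    using W_nth_eq length_W_gt by blast
next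
  fix w assume "\<forall>n. \<forall>r < length (W k n). w r = W k n ! r"
  then show "w = (\<lambda>r. W k r ! r)"
    using length_W_gt by blast
qed

lemma W_inf_nth: "r < length (W k n) \<Longrightarrow> W_inf k r = W k n ! r"
  using theI'[OF W_inf_ex1[of k]] by (simp add: W_inf_def)

lemma suffix_W:
  assumes "1 \<le> n" "n \<le> k - 1"
  shows "suffix [0, n] (W k n)"
  using assms
proof (induction n rule: nat_induct_at_least)
  case base
  then show ?case by (simp add: W_0 W_Suc phi_def phi_letter_def)
next
  case (Suc n)
  then obtain u where u: "W k n = u @ [0, n]"
    by (auto simp: suffix_def)
  have "phi k [n] = [0, Suc n]"
    using Suc by (simp add: phi_def phi_letter_def)
  then have "W k (Suc n) = phi k (u @ [0]) @ [0, Suc n]"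
    using phi_append[of k "u @ [0]" "[n]"] by (simp add: W_Suc u)
  then show ?case by (auto simp: suffix_def)
qed

lemma suffix_W_last:
  assumes "1 \<le> n" "n \<le> k - 1"
  shows "suffix [n] (W k n)"
  using suffix_W[OF assms] by (auto simp: suffix_def)

lemma del_prefix_meaningful:
  "prefix [0] (del_suffix (W k (k - 1) @ W k (k - 1) @ W k (k - 1)) [0, k - 1])"
proof -
  obtain u where "W k (k - 1) = 0 # u"
    using W_starts by blast
  then show ?thesis
    by (auto simp: del_suffix_def)
qed

end

theory Submission
  imports Defs "HOL-Computational_Algebra.Primes"
begin

text \<open>Cut \<open>W_inf k\<close> into maximal runs of letters with the same quotient \<open>a div k\<close> (the class of
  the run).  The morphism acts on the runs, and tracking how images of neighbouring runs merge shows
  that, up to the shift by \<open>k * i\<close>, only finitely many runs occur.  All of them are built from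
  prefixes of the ruler sequence \<open>t \<mapsto> multiplicity 2 t\<close> for \<open>t \<ge> 1\<close>, because \<open>W k n\<close> is
  its prefix of length \<open>2 ^ n\<close> for \<open>n < k\<close>.

  Every run starts with a multiple of \<open>k\<close> and, unless it is a single letter, does not end with one;
  therefore a palindrome of length at least 2 never leaves the run that contains its centre, and the
  maximal palindromes of the infinite word are those of the runs.  In the ruler sequence, the maximal
  palindrome centred at \<open>t\<close> has radius \<open>2 ^ multiplicity 2 t - 1\<close>, which gives \<open>P1\<close>; the ends
  of the runs cut some of these palindromes down to \<open>P2\<close>, and the places where two ruler prefixes
  meet inside a run produce \<open>P3\<close> and \<open>P4\<close>.\<close>

section \<open>The ruler sequence\<close>

text \<open>The obstacle is that the morphism does not map runs to runs. It sends
  \<open>k * i + (k - 1)\<close> to the single letter \<open>k * (i + 1)\<close> of the next class.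
  Inside a run this letter splits the image; at the end of a run it may become an extra leading
  letter of what follows. Such a leading letter comes from the class below, so the runs that descend
  from it, and the palindromes found only in them, need \<open>i \<ge> 1\<close>. This is the origin
  of the condition in \<open>P3\<close> and \<open>P4\<close>. The same letter explains the length
  \<open>2 ^ k - 2\<close>: where the ruler sequence would continue with \<open>0\<close> and
  \<open>k\<close>, the image has \<open>k\<close> alone. It also separates \<open>P4\<close> from
  \<open>P3\<close>. Behind a prefix of length \<open>2 ^ m\<close>, completing the cube of
  \<open>W k m\<close> without its last letter takes \<open>2 * 2 ^ m - 1\<close> more letters, and
  for \<open>m = k - 1\<close> the available \<open>2 ^ k - 2\<close> letters are one too
  few.\<close>

abbreviation ruler :: "nat \<Rightarrow> nat" where
  "ruler \<equiv> multiplicity 2"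

lemma ruler_odd: "odd t \<Longrightarrow> ruler t = 0"
  by (simp add: not_dvd_imp_multiplicity_0)

lemma ruler_double: "0 < t \<Longrightarrow> ruler (2 * t) = Suc (ruler t)"
  by (simp add: multiplicity_times_same)

lemma ruler_eq_0_iff: "0 < t \<Longrightarrow> ruler t = 0 \<longleftrightarrow> odd t"
  by (auto simp: multiplicity_eq_zero_iff)

lemma ruler_power [simp]: "ruler (2 ^ n) = n"
  by (rule multiplicity_same_power) auto

lemma le_ruler_iff: "0 < t \<Longrightarrow> n \<le> ruler t \<longleftrightarrow> 2 ^ n dvd t"
  by (subst power_dvd_iff_le_multiplicity) auto

lemma ruler_less: assumes "0 < t" "t < 2 ^ n" shows "ruler t < n"
proof (rule ccontr)
  assume "\<not> ruler t < n"
  then have "2 ^ n dvd t" using le_ruler_iff[of t n] assms by simp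
  then show False using assms by (auto dest: dvd_imp_le)
qed

lemma ruler_eqI:
  assumes "0 < s" "0 < t" "\<And>n. 2 ^ n dvd s \<longleftrightarrow> (2::nat) ^ n dvd t"
  shows "ruler s = ruler t"
proof (rule antisym)
  show "ruler s \<le> ruler t"
    using le_ruler_iff[of t "ruler s"] assms multiplicity_dvd[of 2 s] by simp
  show "ruler t \<le> ruler s"
    using le_ruler_iff[of s "ruler t"] assms multiplicity_dvd[of 2 t] by simp
qed

lemma dvd_less_power_imp:
  assumes "2 ^ n dvd (e::nat)" "0 < e" "e < 2 ^ a" shows "n \<le> a"
proof (rule ccontr)
  assume "\<not> n \<le> a"
  then have "(2::nat) ^ a \<le> 2 ^ n" by (simp add: power_increasing)
  then show False using dvd_imp_le[OF assms(1,2)] assms(3) by linarith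
qed

text \<open>Numbers congruent modulo \<open>2 ^ a\<close> are divisible by the same powers of 2 up
  to \<open>2 ^ a\<close>, and no higher power divides either, since \<open>2 ^ a\<close> does not
  divide \<open>e\<close>. Together with \<open>ruler_diff\<close> this makes every \<open>t\<close>
  a centre of symmetry up to distance \<open>2 ^ ruler t - 1\<close>.\<close>

lemma ruler_add:
  assumes "2 ^ a dvd t" "0 < e" "e < 2 ^ a"
  shows "ruler (t + e) = ruler e"
proof (rule ruler_eqI)
  fix n :: nat
  have *: "2 ^ n dvd (t::nat)" if "n \<le> a"
    using that assms(1) by (meson dvd_trans le_imp_power_dvd)
  show "2 ^ n dvd t + e \<longleftrightarrow> 2 ^ n dvd e"
  proof (cases "n \<le> a")
    case True
    then show ?thesis using * by (simp add: dvd_add_right_iff)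
  next
    case False
    have "2 ^ a dvd e" if "2 ^ n dvd t + e"
    proof -
      have "2 ^ a dvd (2::nat) ^ n" using False by (simp add: le_imp_power_dvd)
      then have "2 ^ a dvd t + e" using that dvd_trans by blast
      then show ?thesis using assms(1) by (simp add: dvd_add_right_iff)
    qed
    then have "\<not> 2 ^ n dvd t + e" using assms dvd_imp_le[of "2 ^ a" e] by auto
    moreover have "\<not> 2 ^ n dvd e" using False assms dvd_less_power_imp[of n e a] by blast
    ultimately show ?thesis by simp
  qed
qed (use assms in auto)

lemma ruler_diff:
  assumes "2 ^ a dvd t" "0 < e" "e < 2 ^ a" "e < t"
  shows "ruler (t - e) = ruler e"
proof -
  have 1: "2 ^ a \<le> t" using assms by (auto intro: dvd_imp_le)
  \<comment> \<open>\<open>ruler_add\<close> reduces the claim to the multiple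
    \<open>t = 2 ^ a\<close>, where \<open>2 ^ a - e\<close> and \<open>e\<close> are compared
    directly.\<close>
  have "ruler (t - e) = ruler (2 ^ a - e)"
  proof -
    have "2 ^ a dvd t - 2 ^ a" using assms by (simp add: dvd_diff_nat)
    then have "ruler ((t - 2 ^ a) + (2 ^ a - e)) = ruler (2 ^ a - e)"
      by (rule ruler_add) (use assms in auto)
    then show ?thesis using 1 assms by simp
  qed
  also have "\<dots> = ruler e"
  proof (rule ruler_eqI)
    fix n :: nat
    have *: "2 ^ n dvd (2::nat) ^ a" if "n \<le> a" using that by (rule le_imp_power_dvd)
    have "2 ^ n dvd 2 ^ a - e \<Longrightarrow> n \<le> a"
      using assms dvd_less_power_imp[of n "2 ^ a - e" a] by simp
    moreover have "2 ^ n dvd e \<Longrightarrow> n \<le> a"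
      using assms dvd_less_power_imp[of n e a] by simp
    moreover have "n \<le> a \<Longrightarrow> 2 ^ n dvd 2 ^ a - e \<longleftrightarrow> 2 ^ n dvd e"
      using * assms by (metis dvd_diffD1 dvd_diff_nat less_imp_le_nat)
    ultimately show "2 ^ n dvd 2 ^ a - e \<longleftrightarrow> 2 ^ n dvd e" by blast
  qed (use assms in auto)
  finally show ?thesis .
qed

lemma ruler_decomp:
  assumes "0 < t"
  obtains q where "t = 2 ^ ruler t * (2 * q + 1)"
proof -
  obtain x where "t = 2 ^ ruler t * x" "\<not> 2 dvd x"
    using multiplicity_decompose'[of t 2] assms by auto
  then show ?thesis using that by (metis oddE)
qed

text \<open>With \<open>t = 2 ^ v * (2 * q + 1)\<close> the two arguments are
  \<open>2 ^ (v + 1)\<close> times the consecutive numbers \<open>q\<close> and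
  \<open>q + 1\<close>, exactly one of which is odd. Hence the symmetry around \<open>t\<close>
  breaks at distance \<open>2 ^ ruler t\<close>.\<close>

lemma ruler_neq:
  assumes "2 ^ ruler t < t"
  shows "ruler (t - 2 ^ ruler t) \<noteq> ruler (t + 2 ^ ruler t)"
proof -
  define v where "v = ruler t"
  obtain q where q: "t = 2 ^ v * (2 * q + 1)"
    using ruler_decomp assms v_def by (metis gr0I not_less_zero)
  have less: "2 ^ v < t" using assms by (simp add: v_def)
  have "q > 0"
  proof (rule ccontr)
    assume "\<not> q > 0"
    then have "t = 2 ^ v" using q by simp
    then show False using less by simp
  qed
  have *: "ruler (2 ^ n * x) = n + ruler x" if "0 < x" for n x
    using that by (induction n) (simp_all add: ruler_double mult.assoc)
  have "t - 2 ^ v = 2 ^ (v + 1) * q" "t + 2 ^ v = 2 ^ (v + 1) * (q + 1)"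
    by (subst q, simp add: algebra_simps)+
  then have "ruler (t - 2 ^ v) = v + 1 + ruler q" "ruler (t + 2 ^ v) = v + 1 + ruler (q + 1)"
    using *[of q "v + 1"] *[of "q + 1" "v + 1"] \<open>q > 0\<close> by (simp_all only: add_gr_0 zero_less_one simp_thms)
  moreover have "ruler q \<noteq> ruler (q + 1)"
    using ruler_eq_0_iff[of q] ruler_eq_0_iff[of "q + 1"] \<open>q > 0\<close> by (metis add_gr_0 even_plus_one_iff)
  ultimately show ?thesis by (simp add: v_def)
qed

section \<open>Ruler prefixes and their images under the morphism\<close>

definition ruler_word :: "nat \<Rightarrow> nat list" where
  "ruler_word N = map ruler [1..<Suc N]"

lemma length_ruler_word [simp]: "length (ruler_word N) = N"
  by (simp add: ruler_word_def)

lemma nth_ruler_word [simp]: "x < N \<Longrightarrow> ruler_word N ! x = ruler (Suc x)"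
  by (simp add: ruler_word_def del: upt_Suc)

lemma ruler_word_Suc: "ruler_word (Suc N) = ruler_word N @ [ruler (Suc N)]"
  by (simp add: ruler_word_def)

lemma ruler_word_0 [simp]: "ruler_word 0 = []"
  by (simp add: ruler_word_def)

lemma ruler_word_add:
  assumes "M < 2 ^ a"
  shows "ruler_word (2 ^ a + M) = ruler_word (2 ^ a) @ ruler_word M"
proof (rule nth_equalityI)
  fix x assume "x < length (ruler_word (2 ^ a + M))"
  then show "ruler_word (2 ^ a + M) ! x = (ruler_word (2 ^ a) @ ruler_word M) ! x"
    using ruler_add[of a "2 ^ a" "Suc x - 2 ^ a"] assms
    by (auto simp: nth_append Suc_diff_le)
qed simp

lemma phi_Nil [simp]: "phi k [] = []"
  by (simp add: phi_def)

text \<open>Letter by letter this is the recursion \<open>ruler (2 * t - 1) = 0\<close>,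
  \<open>ruler (2 * t) = ruler t + 1\<close>. The bound on \<open>N\<close> keeps out the letter
  \<open>k - 1\<close>, whose image has only one letter.\<close>

lemma phi_ruler_word:
  assumes "N < 2 ^ (k - 1)" "3 \<le> k"
  shows "phi k (ruler_word N) = ruler_word (2 * N)"
  using assms(1)
proof (induction N)
  case (Suc N)
  have "ruler (Suc N) \<le> k - 2"
    using ruler_less[of "Suc N" "k - 1"] Suc.prems by simp
  then have "phi k [ruler (Suc N)] = [0, Suc (ruler (Suc N))]"
    using phi_letter_low[of k "ruler (Suc N)" 0] assms by (simp add: phi_def)
  moreover have "ruler (Suc (2 * N)) = 0" "ruler (Suc (Suc (2 * N))) = Suc (ruler (Suc N))"
    using ruler_double[of "Suc N"] by (simp_all add: ruler_odd)
  ultimately show ?case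
    using Suc by (simp add: ruler_word_Suc phi_append)
qed simp

lemma W_eq_ruler_word:
  assumes "n < k" "3 \<le> k"
  shows "W k n = ruler_word (2 ^ n)"
  using assms(1)
proof (induction n)
  case 0
  then show ?case by (simp add: W_0 ruler_word_def)
next
  case (Suc n)
  then show ?case
    using phi_ruler_word[of "2 ^ n" k] assms power_strict_increasing[of n "k - 1" "2::nat"]
    by (simp add: W_Suc)
qed

text \<open>The last letter is the first \<open>k - 1\<close> of the ruler sequence: all letters
  before it have two-letter images, and its own image is the single letter \<open>k\<close>.\<close>

lemma phi_ruler_word_last:
  assumes "3 \<le> k"
  shows "phi k (ruler_word (2 ^ (k - 1))) = ruler_word (2 ^ k - 2) @ [k]"
proof -
  obtain N :: nat where N: "2 ^ (k - 1) = Suc N" by (metis Suc_pred' zero_less_numeral zero_less_power)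
  have "2 * N = 2 ^ k - 2" using N assms by (cases k) auto
  moreover have "ruler (Suc N) = k - 1" using N by (metis ruler_power)
  moreover have "phi k [k - 1] = [k]" using phi_letter_high[of k 0] assms by (simp add: phi_def)
  ultimately show ?thesis
    using phi_ruler_word[of N k] N assms by (simp add: ruler_word_Suc phi_append)
qed

lemma shift_append: "shift a (u @ v) = shift a u @ shift a v"
  by (simp add: shift_def)

lemma phi_shift:
  assumes "0 < k"
  shows "phi k (shift (k * i) w) = shift (k * i) (phi k w)"
proof (induction w)
  case (Cons a w)
  have "phi_letter k (k * i + a) = shift (k * i) (phi_letter k a)"
    using assms by (auto simp: phi_letter_def shift_def algebra_simps)
  then show ?case using Cons by (simp add: phi_def shift_def)
qed (simp add: phi_def shift_def)

section \<open>Maximal palindromes of finite words\<close>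

text \<open>Palindromes as a symmetry of an index interval, counted from 0. Passing between a run
  and the infinite word then only translates indices.\<close>

definition mirror :: "(nat \<Rightarrow> 'a) \<Rightarrow> nat \<Rightarrow> nat \<Rightarrow> bool" where
  "mirror f p q \<longleftrightarrow> (\<forall>x. p \<le> x \<and> x \<le> q \<longrightarrow> f x = f (p + q - x))"

definition segment :: "(nat \<Rightarrow> 'a) \<Rightarrow> nat \<Rightarrow> nat \<Rightarrow> 'a list" where
  "segment f p q = map f [p..<Suc q]"

text \<open>An end of \<open>u\<close> counts as an obstruction. This suits runs, since a palindrome
  of length at least 2 never leaves the run that contains its centre.\<close>

definition maxpal :: "'a list \<Rightarrow> nat \<Rightarrow> nat \<Rightarrow> bool" where
  "maxpal u p q \<longleftrightarrow> p \<le> q \<and> q < length u \<and> mirror (nth u) p q \<and>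
     (p = 0 \<or> Suc q = length u \<or> u ! (p - 1) \<noteq> u ! (q + 1))"

definition maxpals :: "'a list \<Rightarrow> 'a list set" where
  "maxpals u = {segment (nth u) p q | p q. maxpal u p q \<and> p < q}"

lemma mirror_inner:
  assumes "mirror f p q" "p + q = p' + q'" "p \<le> p'"
  shows "mirror f p' q'"
  unfolding mirror_def
proof (intro allI impI)
  fix x assume "p' \<le> x \<and> x \<le> q'"
  then have "p \<le> x \<and> x \<le> q" using assms by linarith
  then show "f x = f (p' + q' - x)" using assms unfolding mirror_def by metis
qed

lemma mirror_extend:
  assumes "mirror f p q" "0 < p" "f (p - 1) = f (q + 1)"
  shows "mirror f (p - 1) (q + 1)"
  unfolding mirror_def
proof (intro allI impI)
  fix x assume x: "p - 1 \<le> x \<and> x \<le> q + 1"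
  have "p - 1 + (q + 1) = p + q" using assms by simp
  moreover consider "x = p - 1" | "x = q + 1" | "p \<le> x" "x \<le> q" using x assms(2) by linarith
  then have "f x = f (p + q - x)"
  proof cases
    case 1
    then have "p + q - x = q + 1" using assms(2) by simp
    then show ?thesis using 1 assms by simp
  next
    case 2
    then have "p + q - x = p - 1" using assms(2) by simp
    then show ?thesis using 2 assms by simp
  next
    case 3
    then show ?thesis using assms(1) by (simp add: mirror_def)
  qed
  ultimately show "f x = f (p - 1 + (q + 1) - x)" by simp
qed

text \<open>If the second interval were the longer one, its symmetry would identify the letters just
  outside the first, against maximality of the first.\<close>

lemma maxpal_le:
  assumes "maxpal u p q" "maxpal u p' q'" "p + q = p' + q'"
  shows "p \<le> p'"
proof (rule ccontr)
  assume "\<not> p \<le> p'"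
  then have "p' \<le> p - 1" "p - 1 \<le> q'" "p > 0" "q < q'"
    using assms by (auto simp: maxpal_def)
  moreover have "p' + q' - (p - 1) = q + 1" using assms(3) calculation by linarith
  ultimately have "u ! (p - 1) = u ! (q + 1)"
    using assms(2) unfolding maxpal_def mirror_def by metis
  then show False using assms(1,2) \<open>p > 0\<close> \<open>q < q'\<close> by (auto simp: maxpal_def)
qed

lemma maxpal_unique:
  assumes "maxpal u p q" "maxpal u p' q'" "p + q = p' + q'"
  shows "p = p' \<and> q = q'"
  using maxpal_le[OF assms] maxpal_le[OF assms(2,1)] assms(3) by simp

lemma mirror_centre:
  assumes "\<And>e. 1 \<le> e \<Longrightarrow> e \<le> d \<Longrightarrow> f (h - e) = f (h + e)" "d \<le> h"
  shows "mirror f (h - d) (h + d)"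
  unfolding mirror_def
proof (intro allI impI)
  fix x assume x: "h - d \<le> x \<and> x \<le> h + d"
  consider "x = h" | "x < h" | "h < x" by linarith
  then show "f x = f (h - d + (h + d) - x)"
  proof cases
    case 1
    then show ?thesis using assms(2) by simp
  next
    case 2
    then have "h - (h - x) = x" "h + (h - x) = h - d + (h + d) - x"
      using assms(2) by linarith+
    then show ?thesis using assms(1)[of "h - x"] 2 x assms(2) by simp
  next
    case 3
    then obtain e where e: "x = h + e" "1 \<le> e" by (metis less_imp_add_positive Suc_leI One_nat_def)
    then have "h - d + (h + d) - x = h - e" "e \<le> d" using assms(2) x by linarith+
    then show ?thesis using assms(1)[of e] e by simp
  qed
qed

lemma maxpal_centre:
  assumes "\<And>e. 1 \<le> e \<Longrightarrow> e \<le> d \<Longrightarrow> u ! (h - e) = u ! (h + e)"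
    and "d \<le> h" "h + d < length u"
    and "h = d \<or> Suc (h + d) = length u \<or> u ! (h - d - 1) \<noteq> u ! (h + d + 1)"
  shows "maxpal u (h - d) (h + d)"
  unfolding maxpal_def using assms(2,3) mirror_centre[of d "nth u" h, OF assms(1,2)] assms(4)
  by (intro conjI) auto

text \<open>No two adjacent letters agree in an alternating word, so its palindromes have odd length.\<close>

definition alternating :: "nat list \<Rightarrow> bool" where
  "alternating u \<longleftrightarrow> (\<forall>x < length u. u ! x = 0 \<longleftrightarrow> even x)"

lemma alternating_mirror_even:
  assumes "alternating u" "mirror (nth u) p q" "p \<le> q" "q < length u"
  shows "even (p + q)"
proof (rule ccontr)
  assume odd: "odd (p + q)"
  define x where "x = (p + q) div 2"
  have "p \<le> x" "x \<le> q" "p + q - x = Suc x" "Suc x < length u"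
    using odd assms(3,4) unfolding x_def by presburger+
  then have "u ! x = u ! Suc x"
    using assms(2) unfolding mirror_def by metis
  then show False using assms(1) \<open>Suc x < length u\<close> unfolding alternating_def
    by (metis Suc_lessD even_Suc)
qed

lemma alternating_maxpal_centre:
  assumes "alternating u" "maxpal u p q" "p < q"
  obtains h d where "1 \<le> d" "d \<le> h" "p = h - d" "q = h + d" "h < length u"
proof -
  have "even (p + q)" "p < q" "q < length u"
    using assms alternating_mirror_even[of u p q] by (auto simp: maxpal_def)
  then obtain h where h: "p + q = 2 * h" by blast
  then show ?thesis
    using that[of "q - h" h] \<open>p < q\<close> \<open>q < length u\<close> by linarith
qed

lemma segment_take_drop:
  assumes "p \<le> q" "q < length u"
  shows "segment (nth u) p q = take (Suc q - p) (drop p u)"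
  using assms by (intro nth_equalityI) (auto simp: segment_def simp del: upt_Suc)

text \<open>Both halves, read away from the centre, are ruler prefixes. Up to shifts, radius
  \<open>2 ^ v - 1\<close> around \<open>v\<close> gives the words of \<open>P1\<close>, and radius
  \<open>2 ^ j - 2 ^ l\<close> around \<open>j\<close> those of \<open>P2\<close>.\<close>

definition pal_word :: "nat \<Rightarrow> nat \<Rightarrow> nat list" where
  "pal_word v d = rev (ruler_word d) @ [v] @ ruler_word d"

lemma segment_pal_word:
  assumes "\<And>e. 1 \<le> e \<Longrightarrow> e \<le> d \<Longrightarrow> f (h - e) = ruler e \<and> f (h + e) = ruler e" "d \<le> h"
  shows "segment f (h - d) (h + d) = pal_word (f h) d"
proof (rule nth_equalityI)
  show len: "length (segment f (h - d) (h + d)) = length (pal_word (f h) d)"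
    using assms(2) by (simp add: segment_def pal_word_def del: upt_Suc)
  fix x assume "x < length (segment f (h - d) (h + d))"
  then have x: "x \<le> 2 * d" using assms(2) by (simp add: segment_def del: upt_Suc)
  have l: "segment f (h - d) (h + d) ! x = f (h - d + x)"
    using x assms(2) by (simp add: segment_def del: upt_Suc)
  consider "x < d" | "x = d" | "d < x" by linarith
  then show "segment f (h - d) (h + d) ! x = pal_word (f h) d ! x"
  proof cases
    case 1
    then show ?thesis
      using l assms(1)[of "d - x"] assms(2) by (simp add: pal_word_def nth_append rev_nth Suc_diff_Suc)
  next
    case 2
    then show ?thesis using l assms(2) by (simp add: pal_word_def nth_append)
  next
    case 3
    then obtain y where y: "x = d + Suc y" by (metis less_imp_Suc_add add_Suc_right)
    then show ?thesis
      using l assms(1)[of "Suc y"] assms(2) x by (simp add: pal_word_def nth_append)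
  qed
qed

lemma rev_ruler_word_power: "rev (ruler_word (2 ^ n - 1)) = ruler_word (2 ^ n - 1)"
proof (rule nth_equalityI)
  fix x assume "x < length (rev (ruler_word (2 ^ n - 1)))"
  then have x: "Suc x < 2 ^ n" by simp
  then have "2 ^ n - 1 - Suc x < 2 ^ n - 1" "Suc (2 ^ n - 1 - Suc x) = 2 ^ n - Suc x" by linarith+
  then show "rev (ruler_word (2 ^ n - 1)) ! x = ruler_word (2 ^ n - 1) ! x"
    using x ruler_diff[of n "2 ^ n" "Suc x"] by (simp add: rev_nth)
qed simp

lemma pal_word_power: "pal_word n (2 ^ n - 1) = ruler_word (2 ^ Suc n - 1)"
proof -
  obtain N :: nat where N: "2 ^ n = Suc N" by (metis Suc_pred' zero_less_numeral zero_less_power)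
  have "ruler_word (2 ^ n) = ruler_word (2 ^ n - 1) @ [n]"
    using N ruler_power[of n] by (simp add: ruler_word_Suc)
  moreover have "2 ^ Suc n - 1 = 2 ^ n + (2 ^ n - (1::nat))" by simp
  ultimately show ?thesis
    using ruler_word_add[of "2 ^ n - 1" n] rev_ruler_word_power[of n] by (simp add: pal_word_def)
qed

section \<open>Maximal palindromes of a ruler prefix\<close>

lemma dvd_less_add_le:
  fixes a x y :: nat
  assumes "a dvd x" "a dvd y" "x < y"
  shows "x + a \<le> y"
proof -
  have "a dvd y - x" using assms by (simp add: dvd_diff_nat)
  then have "a \<le> y - x" using assms(3) by (simp add: dvd_imp_le)
  then show ?thesis using assms(3) by simp
qed

lemma ruler_around:
  assumes "0 < t" "1 \<le> e" "e < 2 ^ ruler t"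
  shows "ruler (t - e) = ruler e" "ruler (t + e) = ruler e" "e < t"
proof -
  have d: "2 ^ ruler t dvd t" by (simp add: multiplicity_dvd)
  then have "2 ^ ruler t \<le> t" using assms by (auto intro: dvd_imp_le)
  then show "e < t" using assms by simp
  then show "ruler (t - e) = ruler e" "ruler (t + e) = ruler e"
    using ruler_diff[OF d] ruler_add[OF d] assms by auto
qed

lemma power_ruler_le: "0 < t \<Longrightarrow> 2 ^ ruler t \<le> t"
  using dvd_imp_le[OF multiplicity_dvd[of 2 t]] by simp

lemma alternating_ruler_word: "alternating (ruler_word N)"
  by (simp add: alternating_def ruler_eq_0_iff)

text \<open>Here \<open>t\<close> counts letters from 1, while list indices start at 0. Only the
  right end can shorten the natural radius \<open>2 ^ ruler t - 1\<close>, because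
  \<open>2 ^ ruler t \<le> t\<close>.\<close>

lemma maxpal_ruler_word:
  assumes "1 \<le> t" "t \<le> N" "d = min (2 ^ ruler t - 1) (N - t)"
  shows "maxpal (ruler_word N) (t - 1 - d) (t - 1 + d)"
    and "segment (nth (ruler_word N)) (t - 1 - d) (t - 1 + d) = pal_word (ruler t) d"
proof -
  have le: "2 ^ ruler t \<le> t" using power_ruler_le assms by simp
  have d: "d < 2 ^ ruler t" "d \<le> N - t" using assms(3) by (auto simp: min_less_iff_disj)
  have *: "ruler_word N ! (t - 1 - e) = ruler e \<and> ruler_word N ! (t - 1 + e) = ruler e"
    if "1 \<le> e" "e \<le> d" for e
  proof -
    have "Suc (t - 1 - e) = t - e" "Suc (t - 1 + e) = t + e" "t + e \<le> N"
      using that d le assms by linarith+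
    moreover have "ruler (t - e) = ruler e" "ruler (t + e) = ruler e" "t - e > 0"
      using ruler_around[of t e] that d(1) assms(1) by auto
    ultimately show ?thesis by simp
  qed
  show "maxpal (ruler_word N) (t - 1 - d) (t - 1 + d)"
  proof (rule maxpal_centre)
    show "t - 1 = d \<or> Suc (t - 1 + d) = length (ruler_word N)
      \<or> ruler_word N ! (t - 1 - d - 1) \<noteq> ruler_word N ! (t - 1 + d + 1)"
    \<comment> \<open>If \<open>d = N - t\<close>, the palindrome touches the right end. If
      \<open>t = 2 ^ ruler t\<close>, the natural radius is \<open>t - 1\<close>, which touches the
      left end unless the right end comes first.\<close>
    proof (cases "d = N - t \<or> t = 2 ^ ruler t")
      case False
      then have bounds: "d + 1 = 2 ^ ruler t" "d + 1 < t" "t + d + 1 \<le> N"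
        using assms le by auto
      have "Suc (t - 1 - d - 1) = t - 2 ^ ruler t" "Suc (t - 1 + d + 1) = t + 2 ^ ruler t"
        "t - 1 - d - 1 < N" "t - 1 + d + 1 < N" "2 ^ ruler t < t"
        using bounds by linarith+
      then show ?thesis using ruler_neq[of t] by (metis nth_ruler_word)
    next
      case True
      then have "t - 1 = d \<or> Suc (t - 1 + d) = N" using assms by arith
      then show ?thesis by (elim disjE) simp_all
    qed
    show "d \<le> t - 1" "t - 1 + d < length (ruler_word N)" using assms(1,2) d le by auto
  qed (use * in auto)
  show "segment (nth (ruler_word N)) (t - 1 - d) (t - 1 + d) = pal_word (ruler t) d"
    using segment_pal_word[of d "nth (ruler_word N)" "t - 1", OF *] d(1) le assms(1,2)
    by (simp add: nth_ruler_word[of "t - 1"])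
qed

text \<open>A palindrome of length at least 2 in an alternating word has a letter as its centre, and
  each centre has only one maximal palindrome. So exhibiting one for every centre classifies them
  all.\<close>

lemma alternating_maxpals_subset:
  assumes "alternating u"
    and "\<And>h. h < length u \<Longrightarrow>
      \<exists>d\<le>h. maxpal u (h - d) (h + d) \<and> (1 \<le> d \<longrightarrow> segment (nth u) (h - d) (h + d) \<in> S)"
  shows "maxpals u \<subseteq> S"
proof
  fix P assume "P \<in> maxpals u"
  then obtain p q where pq: "maxpal u p q" "p < q" "P = segment (nth u) p q"
    by (auto simp: maxpals_def)
  obtain h d where h: "1 \<le> d" "d \<le> h" "p = h - d" "q = h + d" "h < length u"
    using alternating_maxpal_centre[OF assms(1) pq(1,2)] .
  obtain d' where d': "d' \<le> h" "maxpal u (h - d') (h + d')"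
    "1 \<le> d' \<Longrightarrow> segment (nth u) (h - d') (h + d') \<in> S"
    using assms(2)[OF h(5)] by blast
  have "p + q = h - d' + (h + d')" using h d'(1) by simp
  then have "p = h - d' \<and> q = h + d'" using maxpal_unique pq(1) d'(2) by blast
  then show "P \<in> S" using d'(3) pq(2,3) by (cases d') auto
qed

text \<open>Put \<open>v = ruler t\<close>. Both \<open>t + 2 ^ v\<close> and \<open>2 ^ k\<close>
  are multiples of \<open>2 ^ (v + 1)\<close>. Unless they agree, at least
  \<open>2 ^ (v + 1)\<close> separates them, which leaves room for \<open>2 ^ l\<close> missing
  letters if \<open>l \<le> v + 1\<close>. For larger \<open>l\<close>, \<open>2 ^ k - 2 ^ l\<close>
  is itself a multiple of \<open>2 ^ (v + 1)\<close> and \<open>t\<close> is not, so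
  \<open>t + 2 ^ v\<close> still fits.\<close>

lemma ruler_word_radius_cases:
  assumes "1 \<le> t" "t \<le> 2 ^ k - 2 ^ l" "l < k"
  obtains (inner) "t + 2 ^ ruler t - 1 \<le> 2 ^ k - 2 ^ l" "ruler t + 1 < k"
  | (cut) "t = 2 ^ k - 2 ^ ruler t" "l \<le> ruler t" "ruler t < k"
proof -
  define v where "v = ruler t"
  have dvd: "2 ^ v dvd t" by (simp add: v_def multiplicity_dvd)
  have l: "(2::nat) ^ l < 2 ^ k" using assms by simp
  have tk: "t < 2 ^ k"
    using assms(2) by (rule le_less_trans) simp
  have vk: "v < k" unfolding v_def by (rule ruler_less) (use assms tk in auto)
  have "2 ^ v dvd (2::nat) ^ k" using vk by (simp add: le_imp_power_dvd)
  then have le: "t + 2 ^ v \<le> 2 ^ k" using dvd tk dvd_less_add_le by blast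
  show ?thesis
  proof (cases "t + 2 ^ v = 2 ^ k")
    case True
    have "(2::nat) ^ l \<le> 2 ^ v" using assms(2) True l by linarith
    then have "l \<le> v" by simp
    moreover have "t = 2 ^ k - 2 ^ v" using True by simp
    ultimately show ?thesis using cut[folded v_def] vk by blast
  next
    case False
    obtain q where q: "t = 2 ^ v * (2 * q + 1)"
      using ruler_decomp[of t, folded v_def] assms(1) by (metis One_nat_def Suc_le_lessD)
    have sum: "t + 2 ^ v = 2 ^ (v + 1) * (q + 1)" by (subst q) (simp add: algebra_simps)
    then have dvd2: "2 ^ (v + 1) dvd t + 2 ^ v" by simp
    have "2 ^ (v + 1) dvd (2::nat) ^ k" using vk by (intro le_imp_power_dvd) simp
    then have big: "t + 2 ^ v + 2 ^ (v + 1) \<le> 2 ^ k"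
      using dvd2 dvd_less_add_le False le le_neq_implies_less by blast
    have "t + 2 ^ v - 1 \<le> 2 ^ k - 2 ^ l"
    proof (cases "l \<le> v + 1")
      case True
      then have "(2::nat) ^ l \<le> 2 ^ (v + 1)" by (simp add: power_increasing del: power_Suc)
      then show ?thesis using big by linarith
    next
      case False
      have "2 ^ (v + 1) dvd (2::nat) ^ k - 2 ^ l"
        using False assms by (intro dvd_diff_nat le_imp_power_dvd) auto
      moreover have "\<not> 2 ^ (v + 1) dvd t"
        using le_ruler_iff[of t "v + 1"] assms v_def by simp
      ultimately have "t \<noteq> 2 ^ k - 2 ^ l" by metis
      then have "t < 2 ^ k - 2 ^ l" using assms by simp
      moreover have "2 ^ v dvd (2::nat) ^ k - 2 ^ l"
        using False assms by (intro dvd_diff_nat le_imp_power_dvd) auto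
      ultimately have "t + 2 ^ v \<le> 2 ^ k - 2 ^ l" using dvd dvd_less_add_le by blast
      then show ?thesis by simp
    qed
    moreover have "v + 1 < k"
    proof (rule ccontr)
      assume "\<not> v + 1 < k"
      then have "(2::nat) ^ k \<le> 2 ^ (v + 1)" by (intro power_increasing) auto
      moreover have "2 ^ v > (0::nat)" by simp
      ultimately show False using big by linarith
    qed
    ultimately show ?thesis using inner[folded v_def] by blast
  qed
qed

text \<open>The words of \<open>P1\<close> before shifting: \<open>ruler_word (2 ^ n - 1)\<close> is
  the Zimin word on \<open>n\<close> letters.\<close>

definition zimin_pals :: "nat \<Rightarrow> nat list set" where
  "zimin_pals k = {ruler_word (2 ^ n - 1) | n. 2 \<le> n \<and> n \<le> k - 1}"

text \<open>The words of \<open>P2\<close> before shifting; \<open>l\<close> stands for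
  \<open>n - k + 1\<close>.\<close>

definition cut_pals :: "nat \<Rightarrow> nat list set" where
  "cut_pals k = {pal_word j (2 ^ j - 2 ^ l) | j l. 1 \<le> l \<and> l < j \<and> j < k}"

lemma zimin_palsI: "\<lbrakk>1 \<le> v; v + 1 < k\<rbrakk> \<Longrightarrow> pal_word v (2 ^ v - 1) \<in> zimin_pals k"
  unfolding zimin_pals_def pal_word_power by (rule CollectI, rule exI[of _ "Suc v"]) auto

lemma cut_palsI: "\<lbrakk>1 \<le> l; l < j; j < k\<rbrakk> \<Longrightarrow> pal_word j (2 ^ j - 2 ^ l) \<in> cut_pals k"
  unfolding cut_pals_def by blast

lemma maxpal_in_maxpals:
  assumes "maxpal u (h - d) (h + d)" "1 \<le> d" "segment (nth u) (h - d) (h + d) = P"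
  shows "P \<in> maxpals u"
  using assms unfolding maxpals_def by fastforce

lemma maxpals_ruler_word_cut:
  assumes "1 \<le> l" "l < k"
  shows "maxpals (ruler_word (2 ^ k - 2 ^ l)) \<subseteq> zimin_pals k \<union> cut_pals k"
proof (rule alternating_maxpals_subset[OF alternating_ruler_word])
  let ?N = "2 ^ k - 2 ^ l :: nat"
  fix h assume "h < length (ruler_word ?N)"
  then have t: "1 \<le> Suc h" "Suc h \<le> ?N" by auto
  define v where "v = ruler (Suc h)"
  define d where "d = min (2 ^ v - 1) (?N - Suc h)"
  have m: "maxpal (ruler_word ?N) (h - d) (h + d)"
    "segment (nth (ruler_word ?N)) (h - d) (h + d) = pal_word v d"
    using maxpal_ruler_word[OF t, of d] by (simp_all add: d_def v_def)
  have "2 ^ v \<le> Suc h" using power_ruler_le by (simp add: v_def)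
  then have "d \<le> h" unfolding d_def by linarith
  moreover have "pal_word v d \<in> zimin_pals k \<union> cut_pals k" if "1 \<le> d"
  proof (cases rule: ruler_word_radius_cases[OF t assms(2)])
    case 1
    note inner = this[folded v_def]
    have d: "d = 2 ^ v - 1" unfolding d_def using inner by linarith
    moreover have "1 \<le> v" using that d by (cases v) auto
    ultimately show ?thesis using zimin_palsI inner by simp
  next
    case 2
    note cut = this[folded v_def]
    have "(2::nat) ^ v < 2 ^ k" "(2::nat) ^ l \<le> 2 ^ v" using cut by (simp_all add: power_increasing)
    then have "?N - Suc h = 2 ^ v - 2 ^ l" using cut(1) by linarith
    moreover have "(2::nat) ^ v - 2 ^ l \<le> 2 ^ v - 1" by (simp add: diff_le_mono2)
    ultimately have d: "d = 2 ^ v - 2 ^ l" unfolding d_def by linarith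
    then have "l \<noteq> v" using that by auto
    then show ?thesis using d cut assms(1) cut_palsI[of l v k] by simp
  qed
  ultimately show "\<exists>d\<le>h. maxpal (ruler_word ?N) (h - d) (h + d) \<and>
      (1 \<le> d \<longrightarrow> segment ((!) (ruler_word ?N)) (h - d) (h + d) \<in> zimin_pals k \<union> cut_pals k)"
    using m by auto
qed

lemma cut_pal_in_maxpals:
  assumes "l < j" "j < k"
  shows "pal_word j (2 ^ j - 2 ^ l) \<in> maxpals (ruler_word (2 ^ k - 2 ^ l))"
proof -
  \<comment> \<open>The last position below \<open>2 ^ k\<close> with letter \<open>j\<close>.
    Exactly \<open>2 ^ j - 2 ^ l\<close> letters of the word follow it.\<close>
  define t :: nat where "t = 2 ^ k - 2 ^ j"
  have pow: "(2::nat) ^ l < 2 ^ j" "(2::nat) ^ j < 2 ^ k" "(1::nat) \<le> 2 ^ l" using assms by simp_all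
  have rt: "ruler t = j"
    unfolding t_def using ruler_diff[of k "2 ^ k" "2 ^ j"] pow by simp
  have t: "1 \<le> t" "t \<le> 2 ^ k - 2 ^ l" using pow unfolding t_def by linarith+
  have d: "2 ^ j - 2 ^ l = min (2 ^ ruler t - 1) (2 ^ k - 2 ^ l - t)"
    unfolding rt using pow unfolding t_def by linarith
  have one: "1 \<le> (2 ^ j - 2 ^ l :: nat)" using pow(1) by linarith
  show ?thesis
    using maxpal_in_maxpals[OF maxpal_ruler_word(1)[OF t d] one maxpal_ruler_word(2)[OF t d]] pow(1) rt
    by simp
qed

lemma zimin_pals_subset_maxpals: "zimin_pals k \<subseteq> maxpals (ruler_word (2 ^ k - 2))"
proof
  fix P assume "P \<in> zimin_pals k"
  then obtain n where n: "2 \<le> n" "n \<le> k - 1" "P = ruler_word (2 ^ n - 1)"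
    by (auto simp: zimin_pals_def)
  \<comment> \<open>The centre is \<open>2 ^ v\<close>, the first occurrence of the letter
    \<open>v\<close>; \<open>v + 2 \<le> k\<close> leaves enough letters to its right.\<close>
  define v where "v = n - 1"
  have v: "n = Suc v" "1 \<le> v" "v + 2 \<le> k" using n by (auto simp: v_def)
  have "(2::nat) ^ (v + 2) \<le> 2 ^ k" using v(3) by (rule power_increasing) simp
  then have le: "4 * 2 ^ v \<le> (2::nat) ^ k" by (simp add: power_add)
  have ge: "(2::nat) ^ 1 \<le> 2 ^ v" using v(2) by (rule power_increasing) simp
  have "2 ^ v - 1 = min (2 ^ v - 1) (2 ^ k - 2 - 2 ^ v :: nat)" "2 ^ v \<le> (2 ^ k - 2 :: nat)"
    using le ge by linarith+
  then show "P \<in> maxpals (ruler_word (2 ^ k - 2))"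
    using maxpal_ruler_word[of "2 ^ v" "2 ^ k - 2" "2 ^ v - 1"] ge n(3) v(1) pal_word_power[of v]
    by (intro maxpal_in_maxpals[of _ "2 ^ v - 1" "2 ^ v - 1"]) simp_all
qed

text \<open>For a centre \<open>t < 2 ^ m\<close>, the power \<open>2 ^ ruler t\<close> divides both
  \<open>t\<close> and \<open>2 ^ m\<close>, so the right end shortens no palindrome and nothing
  from \<open>cut_pals\<close> arises.\<close>

lemma maxpals_ruler_word_power:
  assumes "m < k"
  shows "maxpals (ruler_word (2 ^ m)) \<subseteq> zimin_pals k"
proof (rule alternating_maxpals_subset[OF alternating_ruler_word])
  fix h assume "h < length (ruler_word (2 ^ m))"
  then have t: "1 \<le> Suc h" "Suc h \<le> 2 ^ m" by auto
  define v where "v = ruler (Suc h)"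
  define d where "d = min (2 ^ v - 1) (2 ^ m - Suc h)"
  have m: "maxpal (ruler_word (2 ^ m)) (h - d) (h + d)"
    "segment (nth (ruler_word (2 ^ m))) (h - d) (h + d) = pal_word v d"
    using maxpal_ruler_word[OF t, of d] by (simp_all add: d_def v_def)
  have "2 ^ v \<le> Suc h" using power_ruler_le by (simp add: v_def)
  then have "d \<le> h" unfolding d_def by linarith
  moreover have "pal_word v d \<in> zimin_pals k" if "1 \<le> d"
  proof -
    have less: "Suc h < 2 ^ m" using that unfolding d_def by linarith
    then have vm: "v < m" unfolding v_def by (intro ruler_less) auto
    have "2 ^ v dvd (2::nat) ^ m" using vm by (simp add: le_imp_power_dvd)
    moreover have "2 ^ v dvd Suc h" by (simp add: v_def multiplicity_dvd)
    ultimately have "Suc h + 2 ^ v \<le> 2 ^ m" using less dvd_less_add_le by blast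
    then have d: "d = 2 ^ v - 1" unfolding d_def by linarith
    moreover have "1 \<le> v" using that d by (cases v) auto
    ultimately show ?thesis using zimin_palsI vm assms by simp
  qed
  ultimately show "\<exists>d\<le>h. maxpal (ruler_word (2 ^ m)) (h - d) (h + d) \<and>
      (1 \<le> d \<longrightarrow> segment ((!) (ruler_word (2 ^ m))) (h - d) (h + d) \<in> zimin_pals k)"
    using m by auto
qed

text \<open>Parity lets the new letter create only \<open>[0, 0]\<close>. A palindromic prefix of
  \<open>v\<close> has odd length, so it is followed by a nonzero letter or by nothing and cannot
  absorb the \<open>0\<close> in front.\<close>

lemma maxpals_Cons_0:
  assumes "alternating v"
  shows "maxpals (0 # v) \<subseteq> insert [0, 0] (maxpals v)"
    and "maxpals v \<subseteq> maxpals (0 # v)"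
    and "v \<noteq> [] \<Longrightarrow> [0, 0] \<in> maxpals (0 # v)"
proof -
  have Suc_mirror: "mirror (nth (0 # v)) (Suc p) (Suc q) \<longleftrightarrow> mirror (nth v) p q" if "p \<le> q" for p q
  proof -
    have "(0 # v) ! Suc x = (0 # v) ! (Suc p + Suc q - Suc x) \<longleftrightarrow> v ! x = v ! (p + q - x)"
      if "x \<le> q" for x
      using that by (simp add: Suc_diff_le)
    moreover have "(\<forall>x. Suc p \<le> x \<and> x \<le> Suc q \<longrightarrow> F x) \<longleftrightarrow> (\<forall>x. p \<le> x \<and> x \<le> q \<longrightarrow> F (Suc x))" for F
      by (metis Suc_le_D Suc_le_mono)
    ultimately show ?thesis unfolding mirror_def by simp
  qed
  have Suc_segment: "segment (nth (0 # v)) (Suc p) (Suc q) = segment (nth v) p q" for p q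
    by (intro nth_equalityI) (simp_all add: segment_def del: upt_Suc)
  have Suc_maxpal: "maxpal (0 # v) (Suc p) (Suc q) \<longleftrightarrow> maxpal v p q" if "p < q" for p q
  proof -
    have "Suc q = length v \<or> v ! Suc q \<noteq> 0" if *: "mirror (nth v) 0 q" "q < length v"
    proof -
      have "even q" using alternating_mirror_even[OF assms *(1)] *(2) by simp
      then show ?thesis using assms *(2)
        by (metis Suc_lessI alternating_def even_Suc)
    qed
    then show ?thesis using \<open>p < q\<close> Suc_mirror[of p q]
      by (cases p) (auto simp: maxpal_def)
  qed
  show "maxpals (0 # v) \<subseteq> insert [0, 0] (maxpals v)"
  proof
    fix P assume "P \<in> maxpals (0 # v)"
    then obtain p q where pq: "maxpal (0 # v) p q" "p < q" "P = segment (nth (0 # v)) p q"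
      by (auto simp: maxpals_def)
    obtain q' where q': "q = Suc q'" using pq(2) by (cases q) auto
    show "P \<in> insert [0, 0] (maxpals v)"
    proof (cases p)
      case 0
      have "q' < length v" using pq(1) q' by (simp add: maxpal_def)
      have mir: "mirror (nth (0 # v)) 0 q" using pq(1) 0 by (simp add: maxpal_def)
      then have "(0 # v) ! 0 = (0 # v) ! q" unfolding mirror_def by simp
      then have "even q'" using assms \<open>q' < length v\<close> q' by (simp add: alternating_def)
      \<comment> \<open>Otherwise removing both end letters would leave a palindromic prefix of
        \<open>v\<close> of even length \<open>q'\<close>.\<close>
      have "q' = 0"
      proof (rule ccontr)
        assume "q' \<noteq> 0"
        then obtain r where r: "q' = Suc r" by (cases q') auto
        have "mirror (nth (0 # v)) (Suc 0) (Suc r)"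
          using mirror_inner[OF mir] q' r by simp
        then have "mirror (nth v) 0 r" using Suc_mirror by simp
        then have "even r" using alternating_mirror_even[OF assms, of 0 r] \<open>q' < length v\<close> r by simp
        then show False using \<open>even q'\<close> r by simp
      qed
      then have "P = [0, 0]" using pq(3) 0 q' assms \<open>q' < length v\<close>
        by (auto simp: segment_def alternating_def)
      then show ?thesis by simp
    next
      case (Suc p')
      then have "maxpal v p' q'" "p' < q'" "P = segment (nth v) p' q'"
        using pq q' Suc_maxpal[of p' q'] Suc_segment[of p' q'] by auto
      then show ?thesis by (auto simp: maxpals_def)
    qed
  qed
  show "maxpals v \<subseteq> maxpals (0 # v)"
  proof
    fix P assume "P \<in> maxpals v"
    then obtain p q where "maxpal v p q" "p < q" "P = segment (nth v) p q"
      by (auto simp: maxpals_def)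
    then have "maxpal (0 # v) (Suc p) (Suc q) \<and> Suc p < Suc q
        \<and> P = segment (nth (0 # v)) (Suc p) (Suc q)"
      using Suc_maxpal Suc_segment by simp
    then show "P \<in> maxpals (0 # v)" unfolding maxpals_def by blast
  qed
  show "[0, 0] \<in> maxpals (0 # v)" if "v \<noteq> []"
  proof -
    have v0: "v ! 0 = 0" using assms that by (simp add: alternating_def)
    have "mirror (nth (0 # v)) 0 1"
      unfolding mirror_def using v0 by (auto simp: le_Suc_eq)
    then have "maxpal (0 # v) 0 1 \<and> (0::nat) < 1" using that by (simp add: maxpal_def)
    moreover have "segment (nth (0 # v)) 0 1 = [0, 0]" using v0 by (simp add: segment_def)
    ultimately show ?thesis unfolding maxpals_def by (metis (mono_tags, lifting) mem_Collect_eq)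
  qed
qed

section \<open>Two consecutive ruler prefixes\<close>

definition return_word :: "nat \<Rightarrow> nat \<Rightarrow> nat list" where
  "return_word k m = ruler_word (2 ^ m) @ ruler_word (2 ^ k - 2)"

text \<open>The palindrome centred \<open>2 ^ (m - 1)\<close> letters behind the junction. It is the
  cube of \<open>W k m\<close> without its last letter where there is room; for
  \<open>m = k - 1\<close> the second factor is one letter too short, which costs one letter at each
  end.\<close>

definition long_pal :: "nat \<Rightarrow> nat \<Rightarrow> nat list" where
  "long_pal k m = (if m < k - 1 then take (3 * 2 ^ m - 1) (return_word k m) else drop 1 (return_word k m))"

context
  fixes k m M N :: nat and v :: "nat list"
  assumes m: "1 \<le> m" "m < k"
  defines "M \<equiv> 2 ^ m" and "N \<equiv> 2 ^ k - 2" and "v \<equiv> return_word k m"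
begin

lemma return_M_N: "2 \<le> M" "M \<le> N" "even M" "m < k - 1 \<Longrightarrow> 2 * M \<le> N" "m = k - 1 \<Longrightarrow> N + 2 = 2 * M"
proof -
  have "(2::nat) ^ 1 \<le> 2 ^ m" using m(1) by (rule power_increasing) simp
  then show M2: "2 \<le> M" by (simp add: M_def)
  show "even M" using m by (simp add: M_def)
  have k: "(2::nat) ^ k = 2 * 2 ^ (k - 1)" using m by (cases k) auto
  have "(2::nat) ^ m \<le> 2 ^ (k - 1)" using m by (intro power_increasing) auto
  then show "M \<le> N" using M2 k unfolding M_def N_def by linarith
  show "2 * M \<le> N" if "m < k - 1"
  proof -
    have "(2::nat) ^ Suc m \<le> 2 ^ (k - 1)" using that by (intro power_increasing) auto
    then show ?thesis using M2 k unfolding M_def N_def by simp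
  qed
  show "N + 2 = 2 * M" if "m = k - 1"
    using that k M2 unfolding M_def N_def by simp
qed

lemma length_return: "length v = M + N"
  by (simp add: v_def return_word_def M_def N_def)

lemma return_letter:
  "\<lbrakk>1 \<le> s; s \<le> M\<rbrakk> \<Longrightarrow> v ! (s - 1) = ruler s"
  "\<lbrakk>1 \<le> s; s \<le> N\<rbrakk> \<Longrightarrow> v ! (M + s - 1) = ruler s"
  by (auto simp: v_def return_word_def M_def N_def nth_append)

lemma alternating_return: "alternating v"
  unfolding alternating_def
proof (intro allI impI)
  fix x assume x: "x < length v"
  show "v ! x = 0 \<longleftrightarrow> even x"
  proof (cases "x < M")
    case True
    then show ?thesis using return_letter(1)[of "Suc x"] by (simp add: ruler_eq_0_iff)
  next
    case False
    then obtain y where "x = M + y" using le_Suc_ex by (metis linorder_not_less)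
    then show ?thesis
      using return_letter(2)[of "Suc y"] x return_M_N(3) by (simp add: ruler_eq_0_iff length_return)
  qed
qed

lemma ruler_M: "\<lbrakk>1 \<le> e; e < M\<rbrakk> \<Longrightarrow> ruler (M - e) = ruler e" "\<lbrakk>1 \<le> e; e < M\<rbrakk> \<Longrightarrow> ruler (M + e) = ruler e"
  unfolding M_def by (auto intro: ruler_diff[of m "2 ^ m"] ruler_add[of m "2 ^ m"])

text \<open>The centre is the last letter of the first factor. The same self-reverse word
  \<open>ruler_word (M - 1)\<close> lies on both sides of it, and on the left it reaches the start
  of \<open>v\<close>.\<close>

lemma return_square_pal:
  "maxpal v (M - 1 - (M - 1)) (M - 1 + (M - 1))"
  "segment (nth v) (M - 1 - (M - 1)) (M - 1 + (M - 1)) = take (2 * M - 1) v"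
proof -
  note b = return_M_N(1,2)
  show "maxpal v (M - 1 - (M - 1)) (M - 1 + (M - 1))"
  proof (rule maxpal_centre)
    fix e assume e: "1 \<le> e" "e \<le> M - 1"
    then have "v ! (M - e - 1) = ruler (M - e)" "v ! (M + e - 1) = ruler e"
      using return_letter(1)[of "M - e"] return_letter(2)[of e] b by auto
    then show "v ! (M - 1 - e) = v ! (M - 1 + e)"
      using ruler_M(1)[of e] e b by (simp add: diff_commute)
  qed (use b length_return in auto)
  show "segment (nth v) (M - 1 - (M - 1)) (M - 1 + (M - 1)) = take (2 * M - 1) v"
  proof (subst segment_take_drop)
    have "Suc (M - 1 + (M - 1)) - (M - 1 - (M - 1)) = 2 * M - 1" using b by linarith
    then show "take (Suc (M - 1 + (M - 1)) - (M - 1 - (M - 1))) (drop (M - 1 - (M - 1)) v)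
        = take (2 * M - 1) v" by (simp only: diff_self_eq_0 drop_0)
  qed (use b length_return in auto)
qed

text \<open>The last letter \<open>m\<close> of the first factor stands \<open>2 ^ (m - 1)\<close>
  places before the centre, and \<open>ruler (2 ^ m) = m\<close> stands as many places after it. So
  the symmetry does not stop there as it would in general: the first factor read backwards is
  matched with the ruler sequence after \<open>2 ^ m\<close>.\<close>

lemma return_cube_mirror:
  assumes "1 \<le> e" "e < M + 2 ^ (m - 1)" "2 ^ (m - 1) + e \<le> N"
  shows "v ! (M + 2 ^ (m - 1) - 1 - e) = v ! (M + 2 ^ (m - 1) - 1 + e)"
proof -
  define H :: nat where "H = 2 ^ (m - 1)"
  have H: "M = 2 * H" "1 \<le> H" using m by (cases m; simp add: H_def M_def)+
  note e = assms[folded H_def]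
  have right: "v ! (M + H - 1 + e) = ruler (H + e)"
    using return_letter(2)[of "H + e"] e H by simp
  consider "e < H" | "e = H" | f where "e = H + f" "1 \<le> f" "f < M"
    using e H by (metis One_nat_def Suc_leI add_less_cancel_left less_imp_add_positive linorder_neqE_nat add.commute add_lessD1 Suc_eq_plus1)
  then have "v ! (M + H - 1 - e) = ruler (H + e)"
  proof cases
    case 1
    then have "v ! (M + H - 1 - e) = ruler (H - e)"
      using return_letter(2)[of "H - e"] e H return_M_N(2) by (simp add: diff_commute)
    then show ?thesis
      using ruler_around[of H e] 1 e H unfolding H_def by simp
  next
    case 2
    then show ?thesis using return_letter(1)[of M] H by (simp add: mult_2)
  next
    case 3
    have eqs: "M + H - 1 - e = M - f - 1" "H + e = M + f" using 3 H by auto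
    have "v ! (M - f - 1) = ruler (M - f)" using return_letter(1)[of "M - f"] 3 by simp
    then show ?thesis
      using ruler_M[of f] 3(2,3) eqs by metis
  qed
  then show ?thesis using right by (simp add: H_def)
qed

lemma return_cube_pal:
  obtains d where "d \<le> M + 2 ^ (m - 1) - 1" "1 \<le> d"
    "maxpal v (M + 2 ^ (m - 1) - 1 - d) (M + 2 ^ (m - 1) - 1 + d)"
    "segment (nth v) (M + 2 ^ (m - 1) - 1 - d) (M + 2 ^ (m - 1) - 1 + d) = long_pal k m"
proof -
  define H :: nat where "H = 2 ^ (m - 1)"
  define h where "h = M + H - 1"
  have H: "M = 2 * H" "1 \<le> H" using m by (cases m; simp add: H_def M_def)+
  then have "1 \<le> h - 1" using h_def by linarith
  note mir = return_cube_mirror[folded H_def, folded h_def]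
  show ?thesis
  proof (cases "m < k - 1")
    case True
    note b = return_M_N(4)[OF True]
    have "maxpal v (h - h) (h + h)"
      by (rule maxpal_centre) (use mir b H length_return in \<open>auto simp: h_def\<close>)
    moreover have "segment (nth v) (h - h) (h + h) = long_pal k m"
    proof (subst segment_take_drop)
      have "Suc (h + h) - (h - h) = 3 * M - 1" using H h_def by linarith
      then show "take (Suc (h + h) - (h - h)) (drop (h - h) v) = long_pal k m"
        using True by (simp only: diff_self_eq_0 drop_0 long_pal_def v_def M_def if_True)
      show "h + h < length v" using b H h_def length_return by linarith
    qed simp
    ultimately show ?thesis
      using that[folded H_def, folded h_def, of h] \<open>1 \<le> h - 1\<close> by simp
  next
    case False
    then have "m = k - 1" using m by simp
    note b = return_M_N(5)[OF this]
    \<comment> \<open>Radius \<open>h\<close> would need index \<open>2 * h\<close>, but the last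
      index of \<open>v\<close> is \<open>2 * h - 1\<close>.\<close>
    have "maxpal v (h - (h - 1)) (h + (h - 1))"
      by (rule maxpal_centre) (use mir b H length_return in \<open>auto simp: h_def\<close>)
    moreover have "segment (nth v) (h - (h - 1)) (h + (h - 1)) = long_pal k m"
    proof -
      have "h - (h - 1) = 1" "h + (h - 1) = length v - 1" "1 < length v"
        using b H h_def length_return by linarith+
      then have "segment (nth v) (h - (h - 1)) (h + (h - 1)) = drop 1 v"
        by (simp add: segment_take_drop)
      then show ?thesis using False by (simp add: long_pal_def v_def)
    qed
    ultimately show ?thesis
      using that[folded H_def, folded h_def, of "h - 1"] \<open>1 \<le> h - 1\<close> by simp
  qed
qed

lemma return_pals_in_maxpals: "take (2 * M - 1) v \<in> maxpals v" "long_pal k m \<in> maxpals v"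
proof -
  show "take (2 * M - 1) v \<in> maxpals v"
    using maxpal_in_maxpals[OF return_square_pal(1) _ return_square_pal(2)] return_M_N(1) by simp
  show "long_pal k m \<in> maxpals v"
    using return_cube_pal maxpal_in_maxpals by metis
qed

lemma return_first_part:
  assumes "Suc h < M" "d = 2 ^ ruler (Suc h) - 1"
  shows "d \<le> h" "maxpal v (h - d) (h + d)"
    "1 \<le> d \<Longrightarrow> segment (nth v) (h - d) (h + d) \<in> zimin_pals k"
proof -
  define t where "t = Suc h"
  define a where "a = ruler t"
  have le: "2 ^ a \<le> t" using power_ruler_le by (simp add: t_def a_def)
  have d: "d + 1 = 2 ^ a" using assms(2) by (simp add: t_def a_def)
  have am: "a < m" unfolding a_def by (rule ruler_less) (use assms in \<open>auto simp: t_def M_def\<close>)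
  have "2 ^ a dvd t" by (simp add: a_def multiplicity_dvd)
  moreover have "2 ^ a dvd M" using am by (simp add: M_def le_imp_power_dvd)
  ultimately have right: "t + 2 ^ a \<le> M" using assms dvd_less_add_le t_def by blast
  show "d \<le> h" using le d t_def by linarith
  have around: "v ! (h - e) = ruler e \<and> v ! (h + e) = ruler e" if "1 \<le> e" "e \<le> d" for e
  proof -
    have "e < 2 ^ ruler t" using that d unfolding a_def by linarith
    then have "ruler (t - e) = ruler e" "ruler (t + e) = ruler e" "e < t"
      using ruler_around[of t e] that by (auto simp: t_def)
    moreover have "v ! (t - e - 1) = ruler (t - e)" "v ! (t + e - 1) = ruler (t + e)"
      using return_letter(1)[of "t - e"] return_letter(1)[of "t + e"] \<open>e < t\<close> right that d by auto
    ultimately show ?thesis by (simp add: t_def)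
  qed
  show "maxpal v (h - d) (h + d)"
  proof (rule maxpal_centre)
    show "h = d \<or> Suc (h + d) = length v \<or> v ! (h - d - 1) \<noteq> v ! (h + d + 1)"
    proof (cases "t = 2 ^ a")
      case True
      then show ?thesis using d t_def by simp
    next
      case False
      have "v ! (t - 2 ^ a - 1) = ruler (t - 2 ^ a)" "v ! (t + 2 ^ a - 1) = ruler (t + 2 ^ a)"
        using return_letter(1)[of "t - 2 ^ a"] return_letter(1)[of "t + 2 ^ a"] False le right by auto
      moreover have "ruler (t - 2 ^ a) \<noteq> ruler (t + 2 ^ a)"
        using ruler_neq[of t] False le unfolding a_def by simp
      moreover have "h - d - 1 = t - 2 ^ a - 1" "h + d + 1 = t + 2 ^ a - 1"
        using d t_def by linarith+
      ultimately show ?thesis by metis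
    qed
    show "h + d < length v" using right d length_return return_M_N(1) t_def by linarith
  qed (use around \<open>d \<le> h\<close> in auto)
  have "segment (nth v) (h - d) (h + d) = pal_word (v ! h) d"
    by (rule segment_pal_word) (use around \<open>d \<le> h\<close> in auto)
  moreover have "v ! h = a" using return_letter(1)[of t] assms(1) by (simp add: t_def a_def)
  moreover have "d = 2 ^ a - 1" using d by simp
  ultimately show "segment (nth v) (h - d) (h + d) \<in> zimin_pals k" if "1 \<le> d"
    using zimin_palsI[of a k] am m that by (cases a) auto
qed

text \<open>The second factor behaves like a ruler prefix on its own. A palindrome could cross the
  junction only from a centre \<open>s = 2 ^ a\<close>; the letters to compare are then
  \<open>m\<close> and \<open>a + 1\<close>, which agree only at the excluded centre.\<close>

lemma return_second_part:
  assumes s: "1 \<le> s" "s \<le> N" "s \<noteq> 2 ^ (m - 1)"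
    and h: "h = M + s - 1" and d: "d = min (2 ^ ruler s - 1) (N - s)"
  shows "d \<le> h" "maxpal v (h - d) (h + d)"
    "1 \<le> d \<Longrightarrow> segment (nth v) (h - d) (h + d) \<in> zimin_pals k \<union> cut_pals k"
proof -
  define a where "a = ruler s"
  have le: "2 ^ a \<le> s" using power_ruler_le s by (simp add: a_def)
  have d1: "d < 2 ^ a" "s + d \<le> N" using d s by (auto simp: a_def min_less_iff_disj)
  show dh: "d \<le> h" using le d1 h by linarith
  have around: "v ! (h - e) = ruler e \<and> v ! (h + e) = ruler e" if "1 \<le> e" "e \<le> d" for e
  proof -
    have "e < 2 ^ ruler s" using that d1 unfolding a_def by linarith
    then have "ruler (s - e) = ruler e" "ruler (s + e) = ruler e" "e < s"
      using ruler_around[of s e] that s by auto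
    moreover have "v ! (M + (s - e) - 1) = ruler (s - e)" "v ! (M + (s + e) - 1) = ruler (s + e)"
      using return_letter(2)[of "s - e"] return_letter(2)[of "s + e"] \<open>e < s\<close> s that d1 by auto
    moreover have "h - e = M + (s - e) - 1" "h + e = M + (s + e) - 1"
      using h \<open>e < s\<close> s by auto
    ultimately show ?thesis by metis
  qed
  show "maxpal v (h - d) (h + d)"
  proof (rule maxpal_centre)
    show len: "h + d < length v" using d1 h s length_return by linarith
    show "h = d \<or> Suc (h + d) = length v \<or> v ! (h - d - 1) \<noteq> v ! (h + d + 1)"
    proof (cases "d = N - s")
      case True
      then show ?thesis using h s length_return by auto
    next
      case False
      then have d2: "d + 1 = 2 ^ a" "s + 2 ^ a \<le> N"
        using d s d1 unfolding a_def by (simp_all add: min_def split: if_splits)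
      then have right: "v ! (h + d + 1) = ruler (s + 2 ^ a)"
      proof -
        have "h + d + 1 = M + (s + 2 ^ a) - 1" using d2 h s by linarith
        then show ?thesis using return_letter(2)[of "s + 2 ^ a"] d2 s by simp
      qed
      show ?thesis
      proof (cases "s = 2 ^ a")
        case True
        have "h - d - 1 = M - 1" using d2 h True by linarith
        then have "v ! (h - d - 1) = m" using return_letter(1)[of M] return_M_N(1) by (simp add: M_def)
        moreover have "s + 2 ^ a = 2 ^ Suc a" using True by simp
        then have "ruler (s + 2 ^ a) = Suc a" by (metis ruler_power)
        moreover have "m \<noteq> Suc a" using s(3) True by auto
        ultimately show ?thesis using right by simp
      next
        case False
        have "h - d - 1 = M + (s - 2 ^ a) - 1" using d2 h le by linarith
        then have "v ! (h - d - 1) = ruler (s - 2 ^ a)"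
          using return_letter(2)[of "s - 2 ^ a"] False le s by simp
        then show ?thesis using ruler_neq[of s] right False le unfolding a_def by simp
      qed
    qed
  qed (use around dh in auto)
  have "segment (nth v) (h - d) (h + d) = pal_word (v ! h) d"
    by (rule segment_pal_word) (use around dh in auto)
  moreover have "v ! h = a" using return_letter(2)[of s] s h by (simp add: a_def)
  moreover have bound: "s \<le> 2 ^ k - 2 ^ 1" "1 < k" using s m by (simp_all add: N_def)
  have "pal_word a d \<in> zimin_pals k \<union> cut_pals k" if "1 \<le> d"
  proof (cases rule: ruler_word_radius_cases[OF s(1) bound])
    case 1
    then have "s + 2 ^ a - 1 \<le> N" by (simp add: a_def N_def)
    then have "d = 2 ^ a - 1" using d unfolding a_def by linarith
    then show ?thesis using zimin_palsI[of a k] 1(2) that by (cases a) (auto simp: a_def)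
  next
    case 2
    have ak: "(2::nat) ^ a < 2 ^ k" using 2 by (simp add: a_def)
    moreover have "s = 2 ^ k - 2 ^ a" using 2(1) by (simp add: a_def)
    ultimately have "N - s = 2 ^ a - 2" unfolding N_def by linarith
    then have d: "d = 2 ^ a - 2 ^ 1" using d by (simp add: a_def)
    have "1 < a"
    proof (rule ccontr)
      assume "\<not> 1 < a"
      then have "a = 0 \<or> a = 1" by auto
      then show False using that d by auto
    qed
    then show ?thesis using d cut_palsI[of 1 a k] 2(3) by (simp add: a_def)
  qed
  ultimately show "1 \<le> d \<Longrightarrow> segment (nth v) (h - d) (h + d) \<in> zimin_pals k \<union> cut_pals k"
    by simp
qed

lemma maxpals_return:
  "maxpals v \<subseteq> zimin_pals k \<union> cut_pals k \<union> {take (2 * M - 1) v, long_pal k m}"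
proof (rule alternating_maxpals_subset[OF alternating_return])
  fix h assume h: "h < length v"
  let ?S = "zimin_pals k \<union> cut_pals k \<union> {take (2 * M - 1) v, long_pal k m}"
  consider "Suc h < M" | "Suc h = M" | "M < Suc h" by linarith
  then show "\<exists>d\<le>h. maxpal v (h - d) (h + d) \<and> (1 \<le> d \<longrightarrow> segment ((!) v) (h - d) (h + d) \<in> ?S)"
  proof cases
    case 1
    then show ?thesis using return_first_part[OF 1 refl] by blast
  next
    case 2
    then have "h = M - 1" by simp
    then show ?thesis using return_square_pal by auto
  next
    case 3
    then obtain s where s: "h = M + s - 1" "1 \<le> s"
      by (metis Suc_leI add_diff_cancel_left' diff_Suc_1 less_imp_add_positive One_nat_def)
    then have sN: "s \<le> N" using h length_return by simp
    show ?thesis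
    proof (cases "s = 2 ^ (m - 1)")
      case True
      then show ?thesis using return_cube_pal s(1) by (metis UnI2 insertI1 insertI2)
    next
      case False
      then show ?thesis using return_second_part[OF s(2) sN False s(1) refl] by blast
    qed
  qed
qed

end

section \<open>The morphism on runs\<close>

text \<open>In the paper's notation the words of \<open>Cut l\<close>, \<open>Full m\<close> and \<open>Return m\<close> are
  \<open>W_{k-1} W_{k-2} \<dots> W_l\<close>, \<open>W_m\<close> and \<open>W_m W_{k-1} \<dots> W_1\<close>; the other two carry an additional
  leading letter 0.\<close>

datatype run_type = Cut nat | Full nat | Return nat | Zero_Full | Zero_Return

fun run_word :: "nat \<Rightarrow> run_type \<Rightarrow> nat list" where
  "run_word k (Cut l) = ruler_word (2 ^ k - 2 ^ l)"
| "run_word k (Full m) = ruler_word (2 ^ m)"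
| "run_word k (Return m) = return_word k m"
| "run_word k Zero_Full = 0 # ruler_word (2 ^ (k - 1))"
| "run_word k Zero_Return = 0 # return_word k (k - 1)"

definition flatten :: "nat \<Rightarrow> (nat \<times> run_type) list \<Rightarrow> nat list" where
  "flatten k L = concat (map (\<lambda>(i, X). shift (k * i) (run_word k X)) L)"

text \<open>The action of the morphism on runs.  The last letter \<open>k * i + (k - 1)\<close> of a run
  \<open>Cut (k - 1)\<close> or \<open>Zero_Full\<close> has as its image the single letter \<open>k * (i + 1)\<close>; it is merged with
  the image of the next run if that run lies in class \<open>i + 1\<close>.  The flag \<open>pre\<close> says that such a
  letter waits to be merged.\<close>

fun run_image :: "nat \<Rightarrow> bool \<Rightarrow> nat \<Rightarrow> run_type \<Rightarrow> (nat \<times> run_type) list" where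
  "run_image k pre i (Cut l) =
     (if l < k - 1 then [(i, Cut 1), (i + 1, Full 0), (i, Cut (l + 1))] else [(i, Cut 1)])"
| "run_image k pre i (Full m) =
     [(i, if m < k - 2 then Full (m + 1) else if pre then Zero_Full else Cut (k - 1))]"
| "run_image k pre i (Return m) =
     [(i, if m < k - 2 then Return (m + 1) else Zero_Return), (i + 1, Full 0), (i, Cut 2)]"
| "run_image k pre i Zero_Full = [(i, Return 1)]"
| "run_image k pre i Zero_Return =
     [(i, Return 1), (i + 1, Full 0), (i, Cut 1), (i + 1, Full 0), (i, Cut 2)]"

definition pending :: "nat \<Rightarrow> run_type \<Rightarrow> bool" where
  "pending k X \<longleftrightarrow> X = Cut (k - 1) \<or> X = Zero_Full"

fun runs_image :: "nat \<Rightarrow> bool \<Rightarrow> (nat \<times> run_type) list \<Rightarrow> (nat \<times> run_type) list" where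
  "runs_image k pre [] = []"
| "runs_image k pre ((i, X) # L) = run_image k pre i X @
     (if \<not> pending k X then runs_image k False L
      else if L \<noteq> [] \<and> fst (hd L) = i + 1 then runs_image k True L
      else (i + 1, Full 0) # runs_image k False L)"

text \<open>These are the ascents that images of neighbouring runs produce. The indices of a
  \<open>Cut\<close> and of the run after it grow in step until the merging at
  \<open>Cut (k - 1)\<close>; the targets \<open>Full 0\<close> are the isolated letters that split
  an image.\<close>

fun ascends :: "nat \<Rightarrow> run_type \<Rightarrow> run_type \<Rightarrow> bool" where
  "ascends k (Cut l) Y \<longleftrightarrow> Y = Full (l - 1) \<or> 2 \<le> l \<and> Y = Return (l - 1)
     \<or> l = 1 \<and> (Y = Zero_Full \<or> Y = Zero_Return)"
| "ascends k (Return m) Y \<longleftrightarrow> Y = Full 0"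
| "ascends k Zero_Return Y \<longleftrightarrow> Y = Full 0"
| "ascends k _ Y \<longleftrightarrow> False"

definition follows :: "nat \<Rightarrow> nat \<times> run_type \<Rightarrow> nat \<times> run_type \<Rightarrow> bool" where
  "follows k = (\<lambda>(i, X) (i', Y). i' < i \<and> (\<exists>l. Y = Cut l) \<or> i' = i + 1 \<and> ascends k X Y)"

text \<open>\<open>Full (k - 1)\<close> is excluded because its word is that of
  \<open>Cut (k - 1)\<close>, and \<open>Return (k - 1)\<close> because it occurs only behind a
  merged \<open>0\<close>, as \<open>Zero_Return\<close>. The types that descend from a merged
  letter need a class below them, hence \<open>1 \<le> i\<close>.\<close>

fun good :: "nat \<Rightarrow> nat \<times> run_type \<Rightarrow> bool" where
  "good k (i, Cut l) \<longleftrightarrow> 1 \<le> l \<and> l < k"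
| "good k (i, Full m) \<longleftrightarrow> m + 2 \<le> k"
| "good k (i, Return m) \<longleftrightarrow> 1 \<le> m \<and> m + 2 \<le> k \<and> 1 \<le> i"
| "good k (i, _) \<longleftrightarrow> 1 \<le> i"

definition valid :: "nat \<Rightarrow> (nat \<times> run_type) list \<Rightarrow> bool" where
  "valid k L \<longleftrightarrow> (\<forall>x \<in> set L. good k x) \<and> successively (follows k) L"

text \<open>A merged letter can only meet what may follow \<open>Cut (k - 1)\<close> one class
  higher. Conversely \<open>Return (k - 2)\<close> must receive one, because
  \<open>run_image\<close> always turns it into \<open>Zero_Return\<close>.\<close>

definition can_start :: "nat \<Rightarrow> bool \<Rightarrow> (nat \<times> run_type) list \<Rightarrow> bool" where
  "can_start k pre L \<longleftrightarrow> (if pre then L \<noteq> [] \<and> 1 \<le> fst (hd L) \<and> snd (hd L) \<in> {Full (k - 2), Return (k - 2)}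
     else L \<noteq> [] \<longrightarrow> snd (hd L) \<noteq> Return (k - 2))"

lemma ruler_word_1 [simp]: "ruler_word (Suc 0) = [0]"
  by (simp add: ruler_word_def)

lemma Full_0: "run_word k (Full 0) = [0]"
  by simp

lemma flatten_Nil [simp]: "flatten k [] = []"
  by (simp add: flatten_def)

lemma flatten_Cons [simp]: "flatten k ((i, X) # L) = shift (k * i) (run_word k X) @ flatten k L"
  by (simp add: flatten_def)

lemma flatten_append [simp]: "flatten k (L @ L') = flatten k L @ flatten k L'"
  by (simp add: flatten_def)

lemma shift_Nil [simp]: "shift a [] = []"
  by (simp add: shift_def)

lemma shift_Cons [simp]: "shift a (x # w) = (a + x) # shift a w"
  by (simp add: shift_def)

lemma run_image_nonempty: "run_image k pre i X \<noteq> []"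
  by (cases X) auto

lemma runs_image_nonempty: "L \<noteq> [] \<Longrightarrow> runs_image k pre L \<noteq> []"
  by (cases L) (auto simp: run_image_nonempty)

lemma hd_runs_image: "hd (runs_image k pre ((i, X) # L)) = hd (run_image k pre i X)"
  using run_image_nonempty by simp

lemma valid_append_iff:
  "valid k (L @ L') \<longleftrightarrow> valid k L \<and> valid k L' \<and> (L = [] \<or> L' = [] \<or> follows k (last L) (hd L'))"
  by (auto simp: valid_def successively_append_iff)

context
  fixes k :: nat
  assumes k: "3 \<le> k"
begin

text \<open>The run is \<open>W k (k - 1)\<close> followed by a ruler prefix of length
  \<open>2 ^ (k - 1) - 2 ^ l\<close>. The image of the former ends with the isolated letter
  \<open>k\<close>, and the latter doubles in length.\<close>

lemma phi_Cut:
  assumes "1 \<le> l" "l < k - 1"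
  shows "phi k (run_word k (Cut l)) = run_word k (Cut 1) @ [k] @ run_word k (Cut (l + 1))"
proof -
  have "(2::nat) ^ l < 2 ^ (k - 1)" using assms by simp
  moreover have "(2::nat) ^ k = 2 * 2 ^ (k - 1)" using k by (cases k) auto
  ultimately have "(2::nat) ^ k - 2 ^ l = 2 ^ (k - 1) + (2 ^ (k - 1) - 2 ^ l)"
    "2 * (2 ^ (k - 1) - 2 ^ l) = (2::nat) ^ k - 2 ^ (l + 1)" by simp_all
  then show ?thesis
    using ruler_word_add[of "2 ^ (k - 1) - 2 ^ l" "k - 1"] phi_ruler_word_last[OF k]
      phi_ruler_word[of "2 ^ (k - 1) - 2 ^ l" k] k
    by (simp add: phi_append)
qed

lemma power_half: "(2::nat) ^ k - 2 ^ (k - Suc 0) = 2 ^ (k - Suc 0)"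
  using k by (cases k) auto

lemma phi_Cut_last: "phi k (run_word k (Cut (k - 1))) = run_word k (Cut 1) @ [k]"
  using phi_ruler_word_last[OF k] by (simp add: power_half)

lemma phi_Full:
  assumes "m + 2 \<le> k"
  shows "phi k (run_word k (Full m)) = ruler_word (2 ^ (m + 1))"
proof -
  have "(2::nat) ^ m < 2 ^ (k - 1)" using assms by simp
  then show ?thesis using phi_ruler_word[of "2 ^ m" k] k by simp
qed

lemma phi_Return:
  assumes "m + 2 \<le> k"
  shows "phi k (run_word k (Return m)) = return_word k (m + 1) @ [k] @ run_word k (Cut 2)"
  using phi_Full[OF assms] phi_Cut[of 1] k by (simp add: return_word_def phi_append)

lemma phi_Zero: "phi k [0] = ruler_word 2"
  using phi_Full[of 0] k by (simp add: ruler_word_def)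

lemma phi_Zero_Full: "phi k (run_word k Zero_Full) = return_word k 1 @ [k]"
  using phi_append[of k "[0]" "ruler_word (2 ^ (k - 1))"] phi_Zero phi_ruler_word_last[OF k]
  by (simp add: return_word_def)

lemma phi_Zero_Return:
  "phi k (run_word k Zero_Return) =
    return_word k 1 @ [k] @ run_word k (Cut 1) @ [k] @ run_word k (Cut 2)"
  using phi_append[of k "[0]" "return_word k (k - 1)"] phi_Zero phi_ruler_word_last[OF k] phi_Cut[of 1] k
  by (simp add: return_word_def phi_append)

text \<open>The two optional letters stand on opposite sides: the merged one is in
  \<open>run_image\<close> but comes from the preceding run, the pending one comes from this run but
  is placed in a later entry.\<close>

lemma flatten_run_image:
  assumes "good k (i, X)" "can_start k pre ((i, X) # L)"
  shows "flatten k (run_image k pre i X) @ (if pending k X then [k * (i + 1)] else [])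
    = (if pre then [k * i] else []) @ phi k (shift (k * i) (run_word k X))"
proof -
  have phi: "phi k (shift (k * i) w) = shift (k * i) (phi k w)" for w
    using phi_shift[of k] k by simp
  have start: "pre \<Longrightarrow> X = Full (k - 2) \<or> X = Return (k - 2)" "\<not> pre \<Longrightarrow> X \<noteq> Return (k - 2)"
    using assms(2) by (auto simp: can_start_def split: if_splits)
  have "k - Suc 0 \<noteq> k - 2" "Suc (k - 2) = k - Suc 0" "k * Suc i = k * i + k" using k by auto
  note simps = this phi shift_append Full_0 pending_def
  show ?thesis
  proof (cases X)
    case (Cut l)
    then have "\<not> pre" using start by auto
    show ?thesis
    proof (cases "l < k - 1")
      case True
      then show ?thesis using Cut assms(1) \<open>\<not> pre\<close> phi_Cut[of l]
        by (simp add: simps del: run_word.simps mult_Suc_right)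
    next
      case False
      moreover have "l < k" using Cut assms(1) by simp
      ultimately have "l = k - 1" by linarith
      then show ?thesis using Cut \<open>\<not> pre\<close> phi_Cut_last
        by (simp add: simps del: run_word.simps mult_Suc_right)
    qed
  next
    case (Full m)
    then show ?thesis
    proof (cases "m < k - 2")
      case True
      then have "\<not> pre" using Full start by auto
      then show ?thesis using Full True phi_Full[of m] by (simp add: simps)
    next
      case False
      then have "m = k - 2" using Full assms by simp
      then show ?thesis using Full phi_Full[of m] power_half k by (simp add: simps)
    qed
  next
    case (Return m)
    then have m: "m + 2 \<le> k" using assms(1) by simp
    have pre: "pre \<longleftrightarrow> m = k - 2" using start Return by auto
    show ?thesis
    proof (cases "m < k - 2")
      case True
      then show ?thesis using Return phi_Return[OF m] pre
        by (simp add: simps del: run_word.simps(1,2) mult_Suc_right)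
    next
      case False
      then have "m = k - 2" using m by simp
      then show ?thesis using Return phi_Return[OF m] pre
        by (simp add: simps del: run_word.simps(1,2) mult_Suc_right)
    qed
  next
    case Zero_Full
    then have "\<not> pre" using start by auto
    then show ?thesis using Zero_Full phi_Zero_Full
      by (simp add: simps del: run_word.simps(1,2,4) mult_Suc_right)
  next
    case Zero_Return
    then have "\<not> pre" using start by auto
    then show ?thesis using Zero_Return phi_Zero_Return
      by (simp add: simps del: run_word.simps(1,2,5) mult_Suc_right)
  qed
qed

lemma can_start_next:
  assumes "valid k ((i, X) # L)"
  shows "can_start k (pending k X \<and> L \<noteq> [] \<and> fst (hd L) = i + 1) L"
proof (cases L)
  case Nil
  then show ?thesis by (simp add: can_start_def)
next
  case (Cons y L')
  obtain i' Y where y: "y = (i', Y)" by (cases y)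
  have "good k (i, X)" "good k (i', Y)" "follows k (i, X) (i', Y)"
    using assms Cons y by (auto simp: valid_def)
  then show ?thesis using Cons y k
    by (cases X) (auto simp: can_start_def follows_def pending_def)
qed

lemma flatten_runs_image:
  assumes "valid k L" "can_start k pre L"
  shows "flatten k (runs_image k pre L) = (if pre then [k * fst (hd L)] else []) @ phi k (flatten k L)"
  using assms
proof (induction L arbitrary: pre)
  case Nil
  then show ?case by (auto simp: can_start_def split: if_splits)
next
  case (Cons x L)
  obtain i X where x: "x = (i, X)" by (cases x)
  have v: "valid k L" "good k (i, X)" using Cons.prems x by (auto simp: valid_def successively_Cons)
  have s: "can_start k (pending k X \<and> L \<noteq> [] \<and> fst (hd L) = i + 1) L"
    using can_start_next Cons.prems x by blast
  have image: "flatten k (run_image k pre i X) @ (if pending k X then [k * (i + 1)] else [])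
    = (if pre then [k * i] else []) @ phi k (shift (k * i) (run_word k X))"
    by (rule flatten_run_image[of _ _ _ L]) (use v Cons.prems x in auto)
  note IH = Cons.IH[OF v(1) s]
  have "flatten k (runs_image k pre ((i, X) # L)) =
    flatten k (run_image k pre i X) @ (if pending k X then [k * (i + 1)] else []) @ phi k (flatten k L)"
    using IH Full_0 by auto
  then show ?case using image x by (simp add: phi_append)
qed

lemma valid_run_image:
  assumes "good k (i, X)" "can_start k pre ((i, X) # L)"
  shows "valid k (run_image k pre i X)"
  using assms k by (cases X) (auto simp: valid_def follows_def can_start_def successively_Cons)

text \<open>The three claims are the branches of \<open>runs_image\<close>: no pending letter, one
  that merges, one that becomes a run by itself.\<close>

lemma follows_run_image:
  assumes "good k (i, X)" "good k (i', Y)" "follows k (i, X) (i', Y)"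
  shows "\<not> pending k X \<Longrightarrow> follows k (last (run_image k pre i X)) (hd (run_image k False i' Y))"
    and "\<lbrakk>pending k X; i' = i + 1\<rbrakk> \<Longrightarrow> follows k (last (run_image k pre i X)) (hd (run_image k True i' Y))"
    and "\<lbrakk>pending k X; i' \<noteq> i + 1\<rbrakk> \<Longrightarrow> follows k (i + 1, Full 0) (hd (run_image k False i' Y))"
  using assms k by (cases X; cases Y; auto simp: follows_def pending_def)+

lemma follows_run_image_pending:
  assumes "good k (i, X)" "pending k X"
  shows "follows k (last (run_image k pre i X)) (i + 1, Full 0)"
  using assms k by (cases X) (auto simp: follows_def pending_def)

lemma valid_runs_image:
  assumes "valid k L" "can_start k pre L"
  shows "valid k (runs_image k pre L)"
  using assms
proof (induction L arbitrary: pre)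
  case Nil
  then show ?case by (simp add: valid_def)
next
  case (Cons x L)
  obtain i X where x: "x = (i, X)" by (cases x)
  have v: "valid k L" "good k (i, X)" using Cons.prems x by (auto simp: valid_def successively_Cons)
  define pre' where "pre' \<longleftrightarrow> pending k X \<and> L \<noteq> [] \<and> fst (hd L) = i + 1"
  have s: "can_start k pre' L"
    using can_start_next Cons.prems x unfolding pre'_def by blast
  have IH: "valid k (runs_image k pre' L)" by (rule Cons.IH[OF v(1) s])
  have body: "valid k (run_image k pre i X)"
    by (rule valid_run_image[of _ _ _ L]) (use v Cons.prems x in auto)
  have single: "valid k [(i + 1, Full 0)]" using k by (simp add: valid_def)
  show ?case
  proof (cases L)
    case Nil
    then show ?thesis
      using body single x follows_run_image_pending[OF v(2)]
      by (simp add: valid_append_iff) (simp add: valid_def)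
  next
    case (Cons y L')
    obtain i' Y where y: "y = (i', Y)" by (cases y)
    have fol: "good k (i', Y)" "follows k (i, X) (i', Y)"
      using Cons.prems x Cons y by (auto simp: valid_def)
    have hd: "hd (runs_image k p L) = hd (run_image k p i' Y)" for p
      using hd_runs_image Cons y by simp
    note step = follows_run_image[OF v(2) fol]
    consider "\<not> pending k X" | "pending k X" "i' = i + 1" | "pending k X" "i' \<noteq> i + 1" by blast
    then show ?thesis
    proof cases
      case 1
      then have "runs_image k pre (x # L) = run_image k pre i X @ runs_image k pre' L"
        using x pre'_def by simp
      then show ?thesis using IH body step(1) hd 1 pre'_def valid_append_iff by simp
    next
      case 2
      then have "runs_image k pre (x # L) = run_image k pre i X @ runs_image k pre' L"
        using x pre'_def Cons y by simp
      then show ?thesis using IH body step(2) hd 2 pre'_def Cons y valid_append_iff by simp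
    next
      case 3
      then have "runs_image k pre (x # L) = run_image k pre i X @ [(i + 1, Full 0)] @ runs_image k pre' L"
        using x pre'_def Cons y by simp
      moreover have "\<not> pre'" using 3 Cons y pre'_def by simp
      then have "valid k ([(i + 1, Full 0)] @ runs_image k pre' L)"
        unfolding valid_append_iff using IH single step(3) hd 3 by simp
      then have "valid k (run_image k pre i X @ [(i + 1, Full 0)] @ runs_image k pre' L)"
        using body follows_run_image_pending[OF v(2)] 3 valid_append_iff[of k "run_image k pre i X"] by simp
      ultimately show ?thesis by simp
    qed
  qed
qed

end

section \<open>Runs of the infinite word\<close>

definition runs :: "nat \<Rightarrow> nat \<Rightarrow> (nat \<times> run_type) list" where
  "runs k n = (runs_image k False ^^ n) [(0, Full 0)]"

text \<open>The last clause treats the one run whose first and last letters are both multiples of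
  \<open>k\<close>; a change of class on both sides alone would not stop a palindrome centred on
  it.\<close>

definition run_at :: "nat \<Rightarrow> nat \<Rightarrow> nat \<Rightarrow> run_type \<Rightarrow> bool" where
  "run_at k a i X \<longleftrightarrow> good k (i, X)
     \<and> (\<forall>x < length (run_word k X). W_inf k (a + x) = k * i + run_word k X ! x)
     \<and> (0 < a \<longrightarrow> W_inf k (a - 1) div k \<noteq> i)
     \<and> W_inf k (a + length (run_word k X)) div k \<noteq> i
     \<and> (X = Full 0 \<longrightarrow> 0 < a \<longrightarrow> W_inf k (a - 1) \<noteq> W_inf k (a + 1))"

lemma runs_Suc: "runs k (Suc n) = runs_image k False (runs k n)"
  by (simp add: runs_def)

lemma fst_hd_run_image: "fst (hd (run_image k pre i X)) = i"
  by (cases X) auto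

lemma can_start_False: "\<lbrakk>valid k L; L \<noteq> []; fst (hd L) = 0\<rbrakk> \<Longrightarrow> can_start k False L"
  by (cases L) (auto simp: can_start_def valid_def)

lemma length_runs_image: "length L \<le> length (runs_image k pre L)"
proof (induction L arbitrary: pre)
  case (Cons x L)
  obtain i X where x: "x = (i, X)" by (cases x)
  have "1 \<le> length (run_image k pre i X)"
    using run_image_nonempty[of k pre i X] by (cases "run_image k pre i X") auto
  then show ?case using x Cons[of True] Cons[of False] by auto
qed simp

lemma last_ruler_word: "\<lbrakk>0 < N; even N\<rbrakk> \<Longrightarrow> last (ruler_word N) \<noteq> 0"
  by (cases N) (auto simp: ruler_word_Suc ruler_eq_0_iff simp del: even_Suc)

lemma hd_ruler_word: "0 < N \<Longrightarrow> ruler_word N \<noteq> [] \<and> hd (ruler_word N) = 0"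
  by (cases N) (auto simp: ruler_word_def ruler_odd upt_conv_Cons simp del: upt_Suc)

lemma ruler_word_eq_Nil [simp]: "ruler_word N = [] \<longleftrightarrow> N = 0"
  by (metis length_ruler_word list.size(3) length_0_conv)

lemma length_shift [simp]: "length (shift a w) = length w"
  by (simp add: shift_def)

lemma follows_neq: "follows k (i, X) (i', Y) \<Longrightarrow> i \<noteq> i'"
  by (auto simp: follows_def)

lemma flatten_cover:
  assumes "p < length (flatten k L)"
  shows "\<exists>L1 i X L2. L = L1 @ (i, X) # L2 \<and> length (flatten k L1) \<le> p
    \<and> p < length (flatten k L1) + length (run_word k X)"
  using assms
proof (induction L rule: rev_induct)
  case Nil
  then show ?case using flatten_Nil by simp
next
  case (snoc x L)
  obtain i X where x: "x = (i, X)" by (cases x)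
  show ?case
  proof (cases "p < length (flatten k L)")
    case True
    then show ?thesis using snoc.IH by fastforce
  next
    case False
    then have "p < length (flatten k L) + length (run_word k X)"
      using snoc.prems x flatten_append flatten_Cons flatten_Nil by simp
    then show ?thesis using False x by (metis linorder_not_less)
  qed
qed

lemma runs_image_append:
  "\<exists>M pre'. runs_image k pre (L1 @ x # L2) = M @ runs_image k pre' (x # L2)"
proof (induction L1 arbitrary: pre)
  case Nil
  show ?case by (metis append_Nil)
next
  case (Cons y L1)
  obtain i X where y: "y = (i, X)" by (cases y)
  define rest where "rest = L1 @ x # L2"
  define tl where "tl = (if \<not> pending k X then runs_image k False rest
      else if fst (hd rest) = i + 1 then runs_image k True rest
      else (i + 1, Full 0) # runs_image k False rest)"
  have "runs_image k pre ((y # L1) @ x # L2) = run_image k pre i X @ tl"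
    using y by (simp add: tl_def rest_def)
  moreover have "\<exists>M pre'. tl = M @ runs_image k pre' (x # L2)"
    unfolding tl_def using Cons.IH[folded rest_def, of True] Cons.IH[folded rest_def, of False]
    by (metis append_Cons)
  ultimately show ?case by (metis append_assoc)
qed

lemma runs_image_occurs:
  assumes "runs k n = L1 @ x # L2"
  obtains M pre where "runs k (Suc n) = M @ runs_image k pre (x # L2)"
  using runs_image_append[of k False L1 x L2] assms by (auto simp: runs_Suc)

context
  fixes k :: nat
  assumes k: "3 \<le> k"
begin

lemma runs_props:
  "valid k (runs k n) \<and> runs k n \<noteq> [] \<and> fst (hd (runs k n)) = 0 \<and> flatten k (runs k n) = W k n"
proof (induction n)
  case 0
  then show ?case using k Full_0 by (simp add: runs_def valid_def W_0)
next
  case (Suc n)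
  have start: "can_start k False (runs k n)" using Suc can_start_False by blast
  obtain i X L where L: "runs k n = (i, X) # L" using Suc by (metis list.exhaust surj_pair)
  then have "fst (hd (runs k (Suc n))) = 0"
    using Suc hd_runs_image[of k False i X L] fst_hd_run_image by (simp add: runs_Suc)
  then show ?case
    using valid_runs_image[OF k, OF _ start] flatten_runs_image[OF k, OF _ start]
      runs_image_nonempty Suc by (simp add: runs_Suc W_Suc)
qed

lemma runs_Full: "m + 2 \<le> k \<Longrightarrow> runs k m = [(0, Full m)]"
proof (induction m)
  case (Suc m)
  then show ?case by (simp add: runs_Suc pending_def)
qed (simp add: runs_def)

lemma runs_k: "runs k k = [(0, Cut 1), (1, Full 0)]"
proof -
  define m where "m = k - 2"
  have m: "Suc (Suc m) = k" "Suc m = k - Suc 0" "1 \<le> m" using k by (auto simp: m_def)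
  have "runs k m = [(0, Full m)]" by (rule runs_Full) (use m in simp)
  then have "runs k (Suc m) = [(0, Cut (k - 1))]" by (simp add: runs_Suc pending_def m_def)
  then have "runs k (Suc (Suc m)) = [(0, Cut 1), (1, Full 0)]" by (simp add: runs_Suc pending_def)
  then show ?thesis using m(1) by simp
qed

lemma Cut_1_not_pending: "\<not> pending k (Cut (Suc 0))"
  using k by (auto simp: pending_def)

text \<open>The image of the first run begins with that run and adds two more. So the number of runs
  is unbounded, and every position of the infinite word eventually lies before the last run.\<close>

lemma runs_growth: "\<exists>L. runs k (k + n) = (0, Cut 1) # L \<and> n \<le> length L"
proof (induction n)
  case 0
  then show ?case using runs_k by simp
next
  case (Suc n)
  then obtain L where L: "runs k (k + n) = (0, Cut 1) # L" "n \<le> length L" by blast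
  have "runs k (k + Suc n) = (0, Cut 1) # (1, Full 0) # (0, Cut 2) # runs_image k False L"
    using L k by (simp add: runs_Suc Cut_1_not_pending numeral_2_eq_2)
  then show ?case using L length_runs_image[of L k False] by simp
qed

lemma set_ruler_word: "N < 2 ^ k \<Longrightarrow> set (ruler_word N) \<subseteq> {..<k}"
  using ruler_less[of _ k] by (auto simp: ruler_word_def)

lemma power_k: "2 < (2::nat) ^ k" "even ((2::nat) ^ k)"
proof -
  have "(2::nat) ^ 3 \<le> 2 ^ k" using k by (rule power_increasing) simp
  then show "2 < (2::nat) ^ k" by simp
qed (use k in simp)

lemma run_word_letters:
  assumes "good k (i, X)"
  shows "set (run_word k X) \<subseteq> {..<k}" "run_word k X \<noteq> []" "hd (run_word k X) = 0"
    "X \<noteq> Full 0 \<Longrightarrow> last (run_word k X) \<noteq> 0"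
proof -
  have pow: "(2::nat) ^ (k - 1) < 2 ^ k" "0 < (2::nat) ^ (k - 1)" "even ((2::nat) ^ (k - 1))"
    using k by simp_all
  note words = set_ruler_word last_ruler_word hd_ruler_word
  have "set (run_word k X) \<subseteq> {..<k} \<and> run_word k X \<noteq> [] \<and> hd (run_word k X) = 0 \<and>
    (X \<noteq> Full 0 \<longrightarrow> last (run_word k X) \<noteq> 0)"
  proof (cases X)
    case (Cut l)
    then have l: "1 \<le> l" "l < k" using assms by auto
    then have "(2::nat) ^ l < 2 ^ k" "even ((2::nat) ^ k - 2 ^ l)" by simp_all
    then show ?thesis using Cut words[of "2 ^ k - 2 ^ l"] by simp
  next
    case (Full m)
    then have "m < k" "m \<noteq> 0 \<longrightarrow> even ((2::nat) ^ m)" using assms by auto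
    then show ?thesis using Full words[of "2 ^ m"] by auto
  next
    case (Return m)
    then have "(2::nat) ^ m < 2 ^ k" using assms by simp
    then show ?thesis
      using Return words[of "2 ^ m"] words[of "2 ^ k - 2"] power_k by (simp add: return_word_def)
  next
    case Zero_Full
    then show ?thesis using words[of "2 ^ (k - 1)"] pow k by simp
  next
    case Zero_Return
    then show ?thesis
      using words[of "2 ^ (k - 1)"] words[of "2 ^ k - 2"] power_k pow k by (simp add: return_word_def)
  qed
  then show "set (run_word k X) \<subseteq> {..<k}" "run_word k X \<noteq> []" "hd (run_word k X) = 0"
    "X \<noteq> Full 0 \<Longrightarrow> last (run_word k X) \<noteq> 0" by blast+
qed

text \<open>The run after it shows where this run ends. For \<open>X = Full 0\<close> the outer
  letters differ: the next run starts with a multiple of \<open>k\<close>, while the run before is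
  never another \<open>Full 0\<close> and so does not end with one.\<close>

lemma run_at_runs:
  assumes "runs k n = L1 @ (i, X) # L2" "L2 \<noteq> []"
  shows "run_at k (length (flatten k L1)) i X"
proof -
  let ?u = "run_word k X" and ?a = "length (flatten k L1)"
  have valid: "valid k (L1 @ (i, X) # L2)" and W: "W k n = flatten k (L1 @ (i, X) # L2)"
    using runs_props[of n] assms(1) by auto
  obtain i2 Y L3 where L2: "L2 = (i2, Y) # L3" using assms(2) by (cases L2) auto
  have good: "good k (i, X)" "good k (i2, Y)" and fol2: "follows k (i, X) (i2, Y)"
    using valid L2 by (auto simp: valid_def successively_append_iff successively_Cons)
  have Wn: "W k n = flatten k L1 @ shift (k * i) ?u @ shift (k * i2) (run_word k Y) @ flatten k L3"
    using W L2 flatten_append flatten_Cons by simp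
  have Y: "run_word k Y \<noteq> []" "run_word k Y ! 0 = 0"
    using run_word_letters(2,3)[OF good(2)] by (auto simp: hd_conv_nth)
  have letters: "W_inf k (?a + x) = k * i + ?u ! x" if "x < length ?u" for x
    using W_inf_nth[of "?a + x" k n] that by (simp add: Wn nth_append shift_def)
  have nxt: "W_inf k (?a + length ?u) = k * i2"
    using W_inf_nth[of "?a + length ?u" k n] Y by (simp add: Wn nth_append shift_def)
  have prev: "\<exists>i' c. W_inf k (?a - 1) = k * i' + c \<and> c < k \<and> i' \<noteq> i \<and> (X = Full 0 \<longrightarrow> c \<noteq> 0)"
    if "0 < ?a"
  proof -
    have "L1 \<noteq> []" using that flatten_Nil by auto
    then obtain L0 i' X' where L1: "L1 = L0 @ [(i', X')]" by (cases L1 rule: rev_cases) auto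
    have good': "good k (i', X')" and fol: "follows k (i', X') (i, X)"
      using valid L1 by (auto simp: valid_def successively_append_iff)
    note l = run_word_letters[OF good']
    have "length (flatten k L1) \<le> length (W k n)" by (simp add: Wn)
    then have "?a - 1 < length (W k n)" using that by linarith
    then have "W_inf k (?a - 1) = W k n ! (?a - 1)" by (rule W_inf_nth)
    also have "\<dots> = flatten k L1 ! (?a - 1)" using that by (simp add: Wn nth_append)
    also have "\<dots> = last (flatten k L1)" using that by (simp add: last_conv_nth)
    also have "\<dots> = k * i' + last (run_word k X')"
      using l(2) L1 flatten_append flatten_Cons flatten_Nil
      by (simp add: shift_def last_map)
    finally have "W_inf k (?a - 1) = k * i' + last (run_word k X')" .
    moreover have "last (run_word k X') < k" using l(1,2) last_in_set by blast
    moreover have "i' \<noteq> i" using fol follows_neq by blast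
    moreover have "last (run_word k X') \<noteq> 0" if "X = Full 0"
      using l(4) fol that k by (cases X') (auto simp: follows_def)
    ultimately show ?thesis by blast
  qed
  have "W_inf k (?a - 1) div k \<noteq> i \<and> (X = Full 0 \<longrightarrow> W_inf k (?a - 1) \<noteq> W_inf k (?a + 1))" if "0 < ?a"
  proof -
    obtain i' c where *: "W_inf k (?a - 1) = k * i' + c" "c < k" "i' \<noteq> i" "X = Full 0 \<longrightarrow> c \<noteq> 0"
      using prev \<open>0 < ?a\<close> by blast
    have "W_inf k (?a - 1) div k = i'" "W_inf k (?a - 1) mod k = c" using * by simp_all
    moreover have "W_inf k (?a + 1) mod k = 0" if "X = Full 0"
      using nxt that Full_0 by simp
    ultimately show ?thesis using * by metis
  qed
  moreover have "W_inf k (?a + length ?u) div k \<noteq> i"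
    using nxt follows_neq[OF fol2] k by simp
  ultimately show ?thesis using letters good unfolding run_at_def by blast
qed

lemma length_flatten:
  assumes "valid k L"
  shows "length L \<le> length (flatten k L)"
  using assms
proof (induction L)
  case (Cons x L)
  obtain i X where x: "x = (i, X)" by (cases x)
  have "valid k L" "good k (i, X)" using Cons.prems x by (auto simp: valid_def successively_Cons)
  then show ?case using Cons.IH run_word_letters(2)[of i X] flatten_Cons x
    by (cases "run_word k X") auto
qed simp

lemma run_cover: "\<exists>a i X. run_at k a i X \<and> a \<le> p \<and> p < a + length (run_word k X)"
proof -
  define N where "N = k + (p + 1)"
  obtain L where L: "runs k N = (0, Cut 1) # L" "p + 1 \<le> length L"
    using runs_growth[of "p + 1"] unfolding N_def by blast
  \<comment> \<open>The last run of a finite prefix may continue in the infinite word, so it is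
    discarded.\<close>
  define L' where "L' = butlast (runs k N)"
  have runs: "runs k N = L' @ [last (runs k N)]"
    unfolding L'_def using L(1) by (metis append_butlast_last_id list.distinct(1))
  have "p < length L'" unfolding L'_def using L by auto
  moreover have "valid k L'"
    using runs_props[of N] runs valid_append_iff[of k L' "[last (runs k N)]"] by simp
  ultimately have "p < length (flatten k L')" using length_flatten[of L'] by simp
  then obtain L1 i X L2 where *: "L' = L1 @ (i, X) # L2" "length (flatten k L1) \<le> p"
    "p < length (flatten k L1) + length (run_word k X)"
    using flatten_cover by blast
  have "run_at k (length (flatten k L1)) i X"
    by (rule run_at_runs[of N L1 i X "L2 @ [last (runs k N)]"]) (use runs *(1) in auto)
  then show ?thesis using * by blast
qed

text \<open>Used to show that each required type occurs in each class. From \<open>Cut 1\<close>,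
  \<open>Full 0\<close> with the second run one class higher, images lead through
  \<open>Cut l\<close>, \<open>Full (l - 1)\<close> up to \<open>l = k - 1\<close>, then to
  \<open>Cut 1\<close>, \<open>Zero_Full\<close>, through \<open>Cut l\<close>,
  \<open>Return (l - 1)\<close>, and to \<open>Cut 1\<close>, \<open>Zero_Return\<close>. The image
  of \<open>Zero_Return\<close> contains the initial pair one class higher. The nonempty rest
  ensures that the second run is complete as well.\<close>

definition adjacent_runs :: "nat \<times> run_type \<Rightarrow> nat \<times> run_type \<Rightarrow> bool" where
  "adjacent_runs x y \<longleftrightarrow> (\<exists>n L1 L2. runs k n = L1 @ x # y # L2 \<and> L2 \<noteq> [])"

lemma adjacent_runsI: "\<lbrakk>runs k n = L1 @ x # y # L2; L2 \<noteq> []\<rbrakk> \<Longrightarrow> adjacent_runs x y"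
  unfolding adjacent_runs_def by blast

lemma adjacent_runs_run_at:
  assumes "adjacent_runs (i, X) (i', Y)"
  shows "\<exists>a. run_at k a i X" "\<exists>a. run_at k a i' Y"
proof -
  obtain n L1 L2 where *: "runs k n = L1 @ (i, X) # (i', Y) # L2" "L2 \<noteq> []"
    using assms unfolding adjacent_runs_def by blast
  show "\<exists>a. run_at k a i X" using run_at_runs[of n L1 i X "(i', Y) # L2"] * by auto
  show "\<exists>a. run_at k a i' Y" using run_at_runs[of n "L1 @ [(i, X)]" i' Y L2] * by auto
qed

lemma adjacent_Cut_step:
  assumes "adjacent_runs (i, Cut l) (i + 1, Y)" "l < k - 1"
  shows "adjacent_runs (i, Cut (l + 1)) (hd (run_image k False (i + 1) Y))"
proof -
  obtain n L1 L2 where *: "runs k n = L1 @ (i, Cut l) # (i + 1, Y) # L2" "L2 \<noteq> []"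
    using assms unfolding adjacent_runs_def by blast
  obtain M pre where M: "runs k (Suc n) = M @ runs_image k pre ((i, Cut l) # (i + 1, Y) # L2)"
    using runs_image_occurs[OF *(1)] .
  obtain y ys where y: "run_image k False (i + 1) Y = y # ys"
    using run_image_nonempty by (metis list.exhaust)
  have "\<exists>R. R \<noteq> [] \<and> runs_image k False ((i + 1, Y) # L2) = y # R"
    using y *(2) runs_image_nonempty[OF *(2)] by auto
  then obtain R where R: "R \<noteq> []" "runs_image k False ((i + 1, Y) # L2) = y # R" by blast
  have "\<not> pending k (Cut l)" using assms(2) by (simp add: pending_def)
  then have "runs k (Suc n) = (M @ [(i, Cut 1), (i + 1, Full 0)]) @ (i, Cut (l + 1)) # y # R"
    using M R(2) assms(2) by (simp del: runs_image.simps add: runs_image.simps(2)[of k pre i "Cut l"])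
  then show ?thesis using R(1) y adjacent_runsI by (metis list.sel(1))
qed

lemma adjacent_Cut_last_step:
  assumes "adjacent_runs (i, Cut (k - 1)) (i + 1, Y)"
  shows "adjacent_runs (i, Cut 1) (hd (run_image k True (i + 1) Y))"
proof -
  obtain n L1 L2 where *: "runs k n = L1 @ (i, Cut (k - 1)) # (i + 1, Y) # L2" "L2 \<noteq> []"
    using assms unfolding adjacent_runs_def by blast
  obtain M pre where M: "runs k (Suc n) = M @ runs_image k pre ((i, Cut (k - 1)) # (i + 1, Y) # L2)"
    using runs_image_occurs[OF *(1)] .
  obtain y ys where y: "run_image k True (i + 1) Y = y # ys"
    using run_image_nonempty by (metis list.exhaust)
  have "\<exists>R. R \<noteq> [] \<and> runs_image k True ((i + 1, Y) # L2) = y # R"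
    using y *(2) runs_image_nonempty[OF *(2)] by auto
  then obtain R where R: "R \<noteq> []" "runs_image k True ((i + 1, Y) # L2) = y # R" by blast
  have "runs k (Suc n) = M @ (i, Cut 1) # y # R"
    using M R(2) by (simp del: runs_image.simps add: runs_image.simps(2)[of k pre i "Cut (k - Suc 0)"] pending_def)
  then show ?thesis using R(1) y adjacent_runsI by (metis list.sel(1))
qed

lemma adjacent_Cut_Full_step:
  assumes "adjacent_runs (i, Cut 1) (i + 1, Full 0)" "1 \<le> l" "l < k"
  shows "adjacent_runs (i, Cut l) (i + 1, Full (l - 1))"
  using assms(2,3)
proof (induction l rule: nat_induct_at_least)
  case (Suc l)
  then have "adjacent_runs (i, Cut l) (i + 1, Full (l - 1))" by simp
  moreover have "hd (run_image k False (i + 1) (Full (l - 1))) = (i + 1, Full l)"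
    using Suc by simp
  ultimately show ?case using adjacent_Cut_step[of i l "Full (l - 1)"] Suc by simp
qed (use assms(1) in simp)

lemma adjacent_Cut_Zero_Full:
  assumes "adjacent_runs (i, Cut 1) (i + 1, Full 0)"
  shows "adjacent_runs (i, Cut 1) (i + 1, Zero_Full)"
proof -
  have "adjacent_runs (i, Cut (k - 1)) (i + 1, Full (k - 2))"
    using adjacent_Cut_Full_step[OF assms, of "k - 1"] k by (simp add: numeral_2_eq_2)
  then show ?thesis using adjacent_Cut_last_step by fastforce
qed

lemma adjacent_Cut_Return_step:
  assumes "adjacent_runs (i, Cut 1) (i + 1, Full 0)" "2 \<le> l" "l < k"
  shows "adjacent_runs (i, Cut l) (i + 1, Return (l - 1))"
  using assms(2,3)
proof (induction l rule: nat_induct_at_least)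
  case base
  have "adjacent_runs (i, Cut (1 + 1)) (hd (run_image k False (i + 1) Zero_Full))"
    by (rule adjacent_Cut_step) (use adjacent_Cut_Zero_Full[OF assms(1)] k in auto)
  then show ?case by (simp add: numeral_2_eq_2)
next
  case (Suc l)
  then have "adjacent_runs (i, Cut l) (i + 1, Return (l - 1))" by simp
  moreover have "hd (run_image k False (i + 1) (Return (l - 1))) = (i + 1, Return l)"
    using Suc by simp
  ultimately show ?case using adjacent_Cut_step[of i l "Return (l - 1)"] Suc by simp
qed

lemma adjacent_Cut_Zero_Return:
  assumes "adjacent_runs (i, Cut 1) (i + 1, Full 0)"
  shows "adjacent_runs (i, Cut 1) (i + 1, Zero_Return)"
proof -
  have "adjacent_runs (i, Cut (k - 1)) (i + 1, Return (k - 2))"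
    using adjacent_Cut_Return_step[OF assms, of "k - 1"] k by (simp add: numeral_2_eq_2)
  then show ?thesis using adjacent_Cut_last_step by fastforce
qed

lemma adjacent_Cut_Full: "adjacent_runs (i, Cut 1) (i + 1, Full 0)"
proof (induction i)
  case 0
  \<comment> \<open>One step later than \<open>runs_k\<close>, where no run follows the pair
    yet.\<close>
  have "runs k (Suc k) = [] @ (0, Cut 1) # (0 + 1, Full 0) # [(0, Cut 2), (1, Full 1)]"
    using runs_k k by (simp add: runs_Suc Cut_1_not_pending numeral_2_eq_2 pending_def)
  then show ?case by (rule adjacent_runsI) simp
next
  case (Suc i)
  obtain n L1 L2 where *: "runs k n = L1 @ (i, Cut 1) # (i + 1, Zero_Return) # L2"
    using adjacent_Cut_Zero_Return[OF Suc] unfolding adjacent_runs_def by blast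
  then have "runs k n = (L1 @ [(i, Cut 1)]) @ (i + 1, Zero_Return) # L2" by simp
  then obtain M pre where "runs k (Suc n) = M @ runs_image k pre ((i + 1, Zero_Return) # L2)"
    using runs_image_occurs by blast
  then have "runs k (Suc n) = (M @ [(i + 1, Return 1), (i + 2, Full 0)]) @
      (i + 1, Cut 1) # (i + 2, Full 0) # (i + 1, Cut 2) # runs_image k False L2"
    by (simp add: pending_def)
  then have "adjacent_runs (i + 1, Cut 1) (i + 2, Full 0)" by (rule adjacent_runsI) simp
  then show ?case by simp
qed

lemma run_at_Cut: "\<lbrakk>1 \<le> l; l < k\<rbrakk> \<Longrightarrow> \<exists>a. run_at k a i (Cut l)"
  using adjacent_runs_run_at(1) adjacent_Cut_Full_step[OF adjacent_Cut_Full] by blast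

lemma run_at_Return: "\<lbrakk>1 \<le> i; 1 \<le> m; m + 2 \<le> k\<rbrakk> \<Longrightarrow> \<exists>a. run_at k a i (Return m)"
  using adjacent_runs_run_at(2) adjacent_Cut_Return_step[OF adjacent_Cut_Full, of "m + 1" "i - 1"] by simp

lemma run_at_Zero_Return: "1 \<le> i \<Longrightarrow> \<exists>a. run_at k a i Zero_Return"
  using adjacent_runs_run_at(2) adjacent_Cut_Zero_Return[OF adjacent_Cut_Full, of "i - 1"] by simp

end

section \<open>Maximal palindromic factors\<close>

lemma length_segment [simp]: "length (segment f p q) = Suc q - p"
  by (simp add: segment_def del: upt_Suc)

lemma nth_segment: "x < Suc q - p \<Longrightarrow> segment f p q ! x = f (p + x)"
  by (simp add: segment_def del: upt_Suc)

lemma subword_eq_segment: "subword f (Suc p) (Suc q) = segment f p q"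
  by (rule nth_equalityI) (simp_all add: subword_def segment_def del: upt_Suc)

lemma palindrome_segment:
  assumes "p \<le> q"
  shows "palindrome (segment f p q) \<longleftrightarrow> mirror f p q"
proof
  assume *: "palindrome (segment f p q)"
  show "mirror f p q"
    unfolding mirror_def
  proof (intro allI impI)
    fix x assume x: "p \<le> x \<and> x \<le> q"
    have "segment f p q ! (x - p) = rev (segment f p q) ! (x - p)"
      using * by (simp add: palindrome_def)
    also have "\<dots> = segment f p q ! (q - x)"
    proof -
      have "x - p < Suc q - p" "Suc q - p - Suc (x - p) = q - x" using x by linarith+
      then show ?thesis by (simp add: rev_nth)
    qed
    also have "\<dots> = f (p + (q - x))"
      by (rule nth_segment) (use x in linarith)
    also have "segment f p q ! (x - p) = f (p + (x - p))"
      by (rule nth_segment) (use x in linarith)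
    finally show "f x = f (p + q - x)" using x by simp
  qed
next
  assume *: "mirror f p q"
  show "palindrome (segment f p q)"
    unfolding palindrome_def
  proof (rule nth_equalityI)
    fix x assume "x < length (rev (segment f p q))"
    then have x: "x < Suc q - p" by simp
    have "p \<le> p + x \<and> p + x \<le> q" "p + q - (p + x) = p + (q - p - x)"
      "Suc q - p - Suc x = q - p - x" "q - p - x < Suc q - p"
      using x assms by linarith+
    moreover from this have "f (p + x) = f (p + (q - p - x))"
      using * unfolding mirror_def by metis
    ultimately show "rev (segment f p q) ! x = segment f p q ! x"
      using x by (simp add: rev_nth nth_segment)
  qed simp
qed

text \<open>One more letter on each side is enough to test, because any longer palindrome with the
  same centre contains that extension. Positions change here from counting from 1 to counting from
  0.\<close>

lemma maximal_palindromic_factor_iff: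
  "maximal_palindromic_factor f P \<longleftrightarrow>
    (\<exists>p q. p < q \<and> mirror f p q \<and> (p = 0 \<or> f (p - 1) \<noteq> f (q + 1)) \<and> P = segment f p q)"
proof
  assume "maximal_palindromic_factor f P"
  then obtain s where s: "2 \<le> length P" "palindrome P" "1 \<le> s"
    "subword f s (s + length P - 1) = P"
    "\<And>s' t'. \<lbrakk>1 \<le> s'; s' \<le> t'; s' + t' = 2 * s + length P - 1; t' - s' > length P - 1\<rbrakk>
      \<Longrightarrow> \<not> palindrome (subword f s' t')"
    unfolding maximal_palindromic_factor_def by blast
  define p where "p = s - 1"
  define q where "q = s + length P - 2"
  have "s = Suc p" "s + length P - 1 = Suc q" "p < q" using s(1,3) unfolding p_def q_def by linarith+
  then have P: "P = segment f p q" using s(4) subword_eq_segment by metis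
  then have mir: "mirror f p q" using s(2) palindrome_segment \<open>p < q\<close> by (metis less_imp_le_nat)
  have "f (p - 1) \<noteq> f (q + 1)" if "0 < p"
  proof
    assume "f (p - 1) = f (q + 1)"
    then have "mirror f (p - 1) (q + 1)" using mirror_extend mir that by blast
    then have "palindrome (subword f (Suc (p - 1)) (Suc (q + 1)))"
      unfolding subword_eq_segment using palindrome_segment[of "p - 1" "q + 1" f] \<open>p < q\<close> by simp
    moreover have "1 \<le> Suc (p - 1)" "Suc (p - 1) \<le> Suc (q + 1)"
      "Suc (p - 1) + Suc (q + 1) = 2 * s + length P - 1"
      "Suc (q + 1) - Suc (p - 1) > length P - 1"
      using that s(1,3) unfolding p_def q_def by linarith+
    ultimately show False using s(5) by blast
  qed
  then show "\<exists>p q. p < q \<and> mirror f p q \<and> (p = 0 \<or> f (p - 1) \<noteq> f (q + 1)) \<and> P = segment f p q"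
    using mir P \<open>p < q\<close> by blast
next
  assume "\<exists>p q. p < q \<and> mirror f p q \<and> (p = 0 \<or> f (p - 1) \<noteq> f (q + 1)) \<and> P = segment f p q"
  then obtain p q where *: "p < q" "mirror f p q" "p = 0 \<or> f (p - 1) \<noteq> f (q + 1)" "P = segment f p q"
    by blast
  obtain d where d: "q = p + d" "1 \<le> d" using *(1) by (metis One_nat_def Suc_leI less_imp_add_positive)
  have len: "length P = Suc d" using *(4) d by simp
  then have q: "Suc p + length P - 1 = Suc q" using d by simp
  have "\<not> palindrome (subword f s' t')"
    if st: "1 \<le> s'" "s' \<le> t'" "s' + t' = 2 * Suc p + length P - 1" "t' - s' > length P - 1" for s' t'
  proof
    assume pal: "palindrome (subword f s' t')"
    obtain p' q' where p': "s' = Suc p'" "t' = Suc q'"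
      using st(1,2) by (cases s'; cases t') auto
    have "p' + q' = 2 * p + d" "p' + d < q'" using st(3,4) unfolding p' len by simp_all
    then have eqs: "s' = Suc p'" "t' = Suc q'" "p' \<le> q'" "p' + q' = p + q" "p' < p"
      using p' d by simp_all
    have "mirror f p' q'"
      using pal eqs(1,2) palindrome_segment[OF eqs(3), of f] subword_eq_segment[of f p' q'] by simp
    then have "mirror f (p - 1) (q + 1)"
      by (rule mirror_inner) (use eqs in auto)
    moreover have "p - 1 \<le> p - 1 \<and> p - 1 \<le> q + 1" using *(1) by simp
    ultimately have "f (p - 1) = f (p - 1 + (q + 1) - (p - 1))"
      unfolding mirror_def by blast
    then show False using *(3) eqs(5) by simp
  qed
  moreover have "2 \<le> length P" "palindrome P" "subword f (Suc p) (Suc p + length P - 1) = P"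
    using * len d q palindrome_segment[of p q f] subword_eq_segment[of f p q] by simp_all
  ultimately show "maximal_palindromic_factor f P"
    unfolding maximal_palindromic_factor_def by (intro conjI exI[of _ "Suc p"]) auto
qed

lemma take_ruler_word: "M \<le> N \<Longrightarrow> take M (ruler_word N) = ruler_word M"
  by (rule nth_equalityI) auto

lemma ruler_word_double: "ruler_word (2 * 2 ^ m - 1) = ruler_word (2 ^ m) @ ruler_word (2 ^ m - 1)"
proof -
  have "2 * 2 ^ m - 1 = 2 ^ m + (2 ^ m - 1 :: nat)" by simp
  then show ?thesis using ruler_word_add[of "2 ^ m - 1" m] by simp
qed

context
  fixes k :: nat
  assumes k: "3 \<le> k"
begin

lemma k_minus_1: "1 \<le> k - 1" "k - 1 < k"
  using k by simp_all

section \<open>Palindromes of the infinite word and the runs containing their centres\<close>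

lemma run_at_letter:
  "\<lbrakk>run_at k a i X; x < length (run_word k X)\<rbrakk> \<Longrightarrow> W_inf k (a + x) = k * i + run_word k X ! x"
  by (simp add: run_at_def)

text \<open>A letter next to the run has another class, so its mirror image is not in the run and
  must lie beyond the opposite end. Leaving on the left thus means covering the run symmetrically.
  Its first and last letters then agree, which singles out \<open>Full 0\<close>, and there the two
  outer letters differ.\<close>

lemma run_at_mirror_inside:
  assumes run: "run_at k a i X" and mir: "mirror (W_inf k) p q" "p < q"
    and centre: "a \<le> (p + q) div 2" "(p + q) div 2 < a + length (run_word k X)"
  shows "a \<le> p \<and> q < a + length (run_word k X)"
proof -
  define N where "N = length (run_word k X)"
  define c where "c = p + q"
  have c: "2 * a \<le> c" "c < 2 * (a + N)" using centre unfolding c_def N_def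
    by (simp_all add: div_less_iff_less_mult less_eq_div_iff_mult_less_eq)
  have good: "good k (i, X)" using run by (simp add: run_at_def)
  note letters = run_word_letters[OF k good]
  have inside: "W_inf k y div k = i" if "a \<le> y" "y < a + N" for y
  proof -
    have "y - a < N" using that by simp
    then have "W_inf k (a + (y - a)) = k * i + run_word k X ! (y - a)" "run_word k X ! (y - a) < k"
      using run_at_letter[OF run, of "y - a"] subsetD[OF letters(1) nth_mem[of "y - a"]]
      by (simp_all add: N_def)
    then show ?thesis using that(1) by simp
  qed
  have outside: "0 < a \<Longrightarrow> W_inf k (a - 1) div k \<noteq> i" "W_inf k (a + N) div k \<noteq> i"
    using run by (simp_all add: run_at_def N_def)
  have eq: "W_inf k y = W_inf k (c - y)" if "p \<le> y" "y \<le> q" for y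
    using mir(1) that unfolding mirror_def c_def by blast
  have "a \<le> p"
  proof (rule ccontr)
    assume "\<not> a \<le> p"
    then have p: "p \<le> a - 1" "0 < a" "a - 1 \<le> q" using mir(2) c unfolding c_def by linarith+
    then have 1: "W_inf k (a - 1) = W_inf k (c - (a - 1))" using eq by blast
    then have ge: "c - (a - 1) \<ge> a + N"
      using inside[of "c - (a - 1)"] outside(1) p(2) c by fastforce
    then have q: "p \<le> a + N" "a + N \<le> q" using p unfolding c_def by linarith+
    then have 2: "W_inf k (a + N) = W_inf k (c - (a + N))" using eq by blast
    have "c - (a + N) < a + N" using c by presburger
    then have "c - (a + N) < a" using inside[of "c - (a + N)"] outside(2) 2 by fastforce
    \<comment> \<open>The reflections of both outer letters cross the whole run; the two
      inequalities leave the middle of the run as the only centre.\<close>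
    then have cN: "c + 1 = 2 * a + N" using ge by linarith
    have N: "0 < N" using letters(2) by (simp add: N_def)
    have "W_inf k a = W_inf k (c - a)" using eq[of a] p q N by linarith
    moreover have "c - a = a + (N - 1)" using cN N by linarith
    ultimately have "W_inf k (a + 0) = W_inf k (a + (N - 1))" by simp
    then have "run_word k X ! 0 = run_word k X ! (N - 1)"
      using run N unfolding run_at_def N_def[symmetric]
      by (metis add_left_cancel diff_less zero_less_one)
    then have "last (run_word k X) = 0"
      using letters(2,3) by (simp add: N_def last_conv_nth hd_conv_nth)
    then have X: "X = Full 0" using letters(4) by blast
    then have "N = 1" using Full_0 by (simp add: N_def)
    then have "c - (a - 1) = a + 1" using cN p(2) by linarith
    then show False using 1 run X p(2) unfolding run_at_def by metis
  qed
  moreover have "q < a + N"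
  proof (rule ccontr)
    assume "\<not> q < a + N"
    then have q: "a + N \<le> q" "p \<le> a + N" using c unfolding c_def by presburger+
    then have 2: "W_inf k (a + N) = W_inf k (c - (a + N))" using eq by blast
    have "c - (a + N) < a + N" using c by presburger
    then have "c - (a + N) < a" using inside[of "c - (a + N)"] outside(2) 2 by fastforce
    then have "p < a" using q c unfolding c_def by linarith
    then show False using \<open>a \<le> p\<close> by simp
  qed
  ultimately show ?thesis by (simp add: N_def)
qed

lemma run_at_mirror_iff:
  assumes run: "run_at k a i X" and "p \<le> q" "q < length (run_word k X)"
  shows "mirror (W_inf k) (a + p) (a + q) \<longleftrightarrow> mirror (nth (run_word k X)) p q"
proof -
  have "W_inf k (a + x) = W_inf k (a + p + (a + q) - (a + x))
      \<longleftrightarrow> run_word k X ! x = run_word k X ! (p + q - x)" if "p \<le> x" "x \<le> q" for x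
  proof -
    have "a + p + (a + q) - (a + x) = a + (p + q - x)" using that by simp
    moreover have "x < length (run_word k X)" "p + q - x < length (run_word k X)"
      using that assms by linarith+
    ultimately show ?thesis using run unfolding run_at_def by simp
  qed
  moreover have "(\<forall>y. a + p \<le> y \<and> y \<le> a + q \<longrightarrow> F y) \<longleftrightarrow> (\<forall>x. p \<le> x \<and> x \<le> q \<longrightarrow> F (a + x))" for F
  proof (intro iffI allI impI)
    fix y assume F: "\<forall>x. p \<le> x \<and> x \<le> q \<longrightarrow> F (a + x)" and y: "a + p \<le> y \<and> y \<le> a + q"
    then have "p \<le> y - a \<and> y - a \<le> q" "a + (y - a) = y" by linarith+
    then show "F y" using F by metis
  qed simp
  ultimately show ?thesis unfolding mirror_def by simp
qed

lemma run_at_segment: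
  assumes "run_at k a i X" "q < length (run_word k X)"
  shows "segment (W_inf k) (a + p) (a + q) = shift (k * i) (segment (nth (run_word k X)) p q)"
  using assms by (intro nth_equalityI) (auto simp: shift_def nth_segment run_at_def add.assoc)

lemma maximal_palindromic_factor_runs:
  "maximal_palindromic_factor (W_inf k) P \<longleftrightarrow>
    (\<exists>a i X. run_at k a i X \<and> P \<in> shift (k * i) ` maxpals (run_word k X))"
proof
  assume "maximal_palindromic_factor (W_inf k) P"
  then obtain p q where pq: "p < q" "mirror (W_inf k) p q"
    "p = 0 \<or> W_inf k (p - 1) \<noteq> W_inf k (q + 1)" "P = segment (W_inf k) p q"
    unfolding maximal_palindromic_factor_iff by blast
  obtain a i X where run: "run_at k a i X" "a \<le> (p + q) div 2"
    "(p + q) div 2 < a + length (run_word k X)"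
    using run_cover[OF k] by blast
  have in_run: "a \<le> p" "q < a + length (run_word k X)"
    using run_at_mirror_inside[OF run(1) pq(2,1) run(2,3)] by auto
  define p' q' where "p' = p - a" and "q' = q - a"
  have eqs: "p = a + p'" "q = a + q'" "p' < q'" "q' < length (run_word k X)"
    using in_run pq(1) by (auto simp: p'_def q'_def)
  have "mirror (nth (run_word k X)) p' q'"
    using run_at_mirror_iff[OF run(1), of p' q'] pq(2) eqs by simp
  moreover have "p' = 0 \<or> Suc q' = length (run_word k X)
      \<or> run_word k X ! (p' - 1) \<noteq> run_word k X ! (q' + 1)"
  proof (rule ccontr)
    assume *: "\<not> ?thesis"
    then have "p' - 1 < length (run_word k X)" "q' + 1 < length (run_word k X)" using eqs by auto
    then have "W_inf k (a + (p' - 1)) = W_inf k (a + (q' + 1))"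
      using run_at_letter[OF run(1), of "p' - 1"] run_at_letter[OF run(1), of "q' + 1"] * by metis
    moreover have "a + (p' - 1) = p - 1" "a + (q' + 1) = q + 1" "p \<noteq> 0" using eqs * by auto
    ultimately show False using pq(3) by metis
  qed
  ultimately have "maxpal (run_word k X) p' q'" using eqs by (simp add: maxpal_def)
  then have "segment (nth (run_word k X)) p' q' \<in> maxpals (run_word k X)"
    using eqs unfolding maxpals_def by blast
  moreover have "P = shift (k * i) (segment (nth (run_word k X)) p' q')"
    using pq(4) run_at_segment[OF run(1) eqs(4)] eqs by simp
  ultimately show "\<exists>a i X. run_at k a i X \<and> P \<in> shift (k * i) ` maxpals (run_word k X)"
    using run(1) by blast
next
  assume "\<exists>a i X. run_at k a i X \<and> P \<in> shift (k * i) ` maxpals (run_word k X)"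
  then obtain a i X p q where run: "run_at k a i X" and pq: "maxpal (run_word k X) p q" "p < q"
    "P = shift (k * i) (segment (nth (run_word k X)) p q)"
    unfolding maxpals_def by blast
  have q: "q < length (run_word k X)" and mir: "mirror (nth (run_word k X)) p q"
    using pq by (auto simp: maxpal_def)
  have W: "mirror (W_inf k) (a + p) (a + q)"
    using run_at_mirror_iff[OF run _ q, of p] mir pq(2) by simp
  have neq: "W_inf k (a + p - 1) \<noteq> W_inf k (a + q + 1)" if pos: "0 < a + p"
  proof
    assume *: "W_inf k (a + p - 1) = W_inf k (a + q + 1)"
    \<comment> \<open>The extension has the same centre, so it would stay inside the run and
      contradict maximality there.\<close>
    have "mirror (W_inf k) (a + p - 1) (a + q + 1)" by (rule mirror_extend[OF W pos *])
    moreover have "a + p - 1 + (a + q + 1) = 2 * a + (p + q)" using pos by simp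
    then have "a \<le> (a + p - 1 + (a + q + 1)) div 2"
      "(a + p - 1 + (a + q + 1)) div 2 < a + length (run_word k X)" using q pq(2) by linarith+
    ultimately have "a \<le> a + p - 1 \<and> a + q + 1 < a + length (run_word k X)"
      using run_at_mirror_inside[OF run, of "a + p - 1" "a + q + 1"] pq(2) by simp
    then have b: "1 \<le> p" "q + 1 < length (run_word k X)" using pos by linarith+
    then have "W_inf k (a + (p - 1)) = W_inf k (a + (q + 1))" using * by simp
    moreover have "p - 1 < length (run_word k X)" using b pq(2) by simp
    ultimately have "run_word k X ! (p - 1) = run_word k X ! (q + 1)"
      using run_at_letter[OF run, of "p - 1"] run_at_letter[OF run b(2)] by simp
    then show False using pq(1) b unfolding maxpal_def by simp
  qed
  moreover have "P = segment (W_inf k) (a + p) (a + q)" using pq(3) run_at_segment[OF run q] by simp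
  moreover have "a + p < a + q" using pq(2) by simp
  ultimately show "maximal_palindromic_factor (W_inf k) P"
    using W unfolding maximal_palindromic_factor_iff by blast
qed

section \<open>The four families written with ruler prefixes\<close>

lemma P1_eq: "P1 k = {shift (k * i) w | w i. w \<in> zimin_pals k}"
proof -
  have "del_suffix (W k n) [n] = ruler_word (2 ^ n - 1)" if "n \<le> k - 1" for n
    using that k by (simp add: W_eq_ruler_word del_suffix_def take_ruler_word)
  then show ?thesis unfolding P1_def zimin_pals_def by (auto; metis)
qed

text \<open>The descending order matters: \<open>ruler_word (2 ^ j)\<close> followed by a shorter
  ruler prefix is again a ruler prefix. The lengths form a geometric sum.\<close>

lemma Z_eq:
  assumes "l = n - k + 1" "l \<le> j" "j \<le> k"
  shows "Z k n j = ruler_word (2 ^ j - 2 ^ l)"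
proof -
  have "concat (map (W k) (rev [l..<j])) = ruler_word (2 ^ j - 2 ^ l)"
    using assms(2,3)
  proof (induction j rule: dec_induct)
    case (step j)
    have "(2::nat) ^ l \<le> 2 ^ j" using step(1) by (rule power_increasing) simp
    then have "(2::nat) ^ Suc j - 2 ^ l = 2 ^ j + (2 ^ j - 2 ^ l)" by simp
    then show ?case
      using step k ruler_word_add[of "2 ^ j - 2 ^ l" j] by (simp add: W_eq_ruler_word)
  qed simp
  then show ?thesis using assms(1) by (simp add: Z_def)
qed

lemma P2_eq: "P2 k = {shift (k * i) w | w i. w \<in> cut_pals k}"
proof (intro equalityI subsetI)
  fix P assume "P \<in> P2 k"
  then obtain n j i where *: "P = shift (k * i) (rev (Z k n j) @ [j] @ Z k n j)"
    "k \<le> n" "n \<le> 2 * k - 3" "n - k + 2 \<le> j" "j \<le> k - 1"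
    unfolding P2_def by blast
  then have "P = shift (k * i) (pal_word j (2 ^ j - 2 ^ (n - k + 1)))"
    using Z_eq[OF refl, of n j] by (simp add: pal_word_def)
  moreover have "pal_word j (2 ^ j - 2 ^ (n - k + 1)) \<in> cut_pals k"
    by (rule cut_palsI) (use * k in linarith)+
  ultimately show "P \<in> {shift (k * i) w | w i. w \<in> cut_pals k}" by blast
next
  fix P assume "P \<in> {shift (k * i) w | w i. w \<in> cut_pals k}"
  then obtain i j l where *: "P = shift (k * i) (pal_word j (2 ^ j - 2 ^ l))" "1 \<le> l" "l < j" "j < k"
    unfolding cut_pals_def by blast
  define n where "n = l + k - 1"
  have n: "l = n - k + 1" "k \<le> n" "n \<le> 2 * k - 3" "n - k + 2 \<le> j" "j \<le> k - 1"
    using * unfolding n_def by linarith+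
  then have "P = shift (k * i) (rev (Z k n j) @ [j] @ Z k n j)"
    using Z_eq[OF n(1), of j] * by (simp add: pal_word_def)
  then show "P \<in> P2 k" unfolding P2_def using n by blast
qed

lemma square_eq:
  assumes "1 \<le> m" "m < k"
  shows "del_suffix (W k m @ W k m) [m] = take (2 * 2 ^ m - 1) (return_word k m)"
proof -
  have "2 ^ m \<le> (2 ^ k - 2 :: nat)" using return_M_N(2)[OF assms] .
  then show ?thesis
    using assms k by (simp add: W_eq_ruler_word del_suffix_def return_word_def take_ruler_word mult_2)
qed

lemma cube_eq:
  assumes "1 \<le> m" "m < k - 1"
  shows "del_suffix (W k m @ W k m @ W k m) [m] = long_pal k m"
proof -
  have N: "2 * 2 ^ m \<le> (2 ^ k - 2 :: nat)" using return_M_N(4)[of m k] assms by simp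
  have "long_pal k m = ruler_word (2 ^ m) @ take (2 * 2 ^ m - 1) (ruler_word (2 ^ k - 2))"
    using assms by (simp add: long_pal_def return_word_def)
  also have "take (2 * 2 ^ m - 1) (ruler_word (2 ^ k - 2)) = ruler_word (2 ^ m) @ ruler_word (2 ^ m - 1)"
    using N ruler_word_double[of m] take_ruler_word[of "2 * 2 ^ m - 1" "2 ^ k - 2"] by simp
  finally show ?thesis
    using assms k by (simp add: W_eq_ruler_word del_suffix_def take_ruler_word)
qed

text \<open>\<open>ruler_word (2 ^ k - 2)\<close> is the square of \<open>W k (k - 1)\<close>
  without its last letters \<open>0\<close> and \<open>k - 1\<close>. So the deletion at the end
  yields the return word, and the deletion in front is the \<open>drop 1\<close> of
  \<open>long_pal\<close>.\<close>

lemma truncated_cube_eq: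
  "del_prefix [0] (del_suffix (W k (k - 1) @ W k (k - 1) @ W k (k - 1)) [0, k - 1]) = long_pal k (k - 1)"
proof -
  define M :: nat where "M = 2 ^ (k - 1)"
  have M: "2 \<le> M" "2 ^ k - 2 + 2 = 2 * M"
    using return_M_N(1,5)[of "k - 1" k] k unfolding M_def by simp_all
  have "ruler_word (2 ^ k - 2) = take (2 * M - 2) (ruler_word (2 * M - 1))"
  proof -
    have "2 ^ k - 2 = 2 * M - 2" "2 * M - 2 \<le> 2 * M - 1" using M(2) by linarith+
    then show ?thesis using take_ruler_word[of "2 * M - 2" "2 * M - 1"] by metis
  qed
  also have "\<dots> = ruler_word M @ ruler_word (M - 2)"
    using M(1) ruler_word_double[of "k - 1", folded M_def] take_ruler_word[of "M - 2" "M - 1"]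
    by simp
  finally have "long_pal k (k - 1) = drop 1 (ruler_word M @ ruler_word M @ ruler_word (M - 2))"
    by (simp add: long_pal_def return_word_def M_def)
  moreover have "W k (k - 1) = ruler_word M" using W_eq_ruler_word[of "k - 1" k] k by (simp add: M_def)
  moreover have "del_suffix (ruler_word M @ ruler_word M @ ruler_word M) [0, k - 1]
      = ruler_word M @ ruler_word M @ ruler_word (M - 2)"
    using M(1) by (simp add: del_suffix_def take_ruler_word)
  ultimately show ?thesis by (simp add: del_prefix_def)
qed

lemma P3_eq:
  "P3 k = {shift (k * i) w | w m i. 1 \<le> m \<and> m + 2 \<le> k \<and> 1 \<le> i
    \<and> w \<in> {take (2 * 2 ^ m - 1) (return_word k m), long_pal k m}}"
proof -
  have idx: "(\<exists>n. m = n - 2 * k + 1 \<and> 2 * k \<le> n \<and> n \<le> 3 * k - 3) \<longleftrightarrow> 1 \<le> m \<and> m + 2 \<le> k" for m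
  proof
    assume "1 \<le> m \<and> m + 2 \<le> k"
    then show "\<exists>n. m = n - 2 * k + 1 \<and> 2 * k \<le> n \<and> n \<le> 3 * k - 3"
      by (intro exI[of _ "m + 2 * k - 1"] conjI; linarith)
  next
    assume "\<exists>n. m = n - 2 * k + 1 \<and> 2 * k \<le> n \<and> n \<le> 3 * k - 3"
    then obtain n where "m = n - 2 * k + 1" "2 * k \<le> n" "n \<le> 3 * k - 3" by blast
    then show "1 \<le> m \<and> m + 2 \<le> k" using k by presburger
  qed
  have "P3 k = {shift (k * i) w | w m i. (\<exists>n. m = n - 2 * k + 1 \<and> 2 * k \<le> n \<and> n \<le> 3 * k - 3) \<and> 1 \<le> i
    \<and> w \<in> {del_suffix (W k m @ W k m) [m], del_suffix (W k m @ W k m @ W k m) [m]}}"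
    unfolding P3_def by blast
  also have "\<dots> = {shift (k * i) w | w m i. 1 \<le> m \<and> m + 2 \<le> k \<and> 1 \<le> i
    \<and> w \<in> {del_suffix (W k m @ W k m) [m], del_suffix (W k m @ W k m @ W k m) [m]}}"
    unfolding idx by blast
  also have "\<dots> = {shift (k * i) w | w m i. 1 \<le> m \<and> m + 2 \<le> k \<and> 1 \<le> i
    \<and> w \<in> {take (2 * 2 ^ m - 1) (return_word k m), long_pal k m}}"
  proof -
    have "{del_suffix (W k m @ W k m) [m], del_suffix (W k m @ W k m @ W k m) [m]}
        = {take (2 * 2 ^ m - 1) (return_word k m), long_pal k m}" if "1 \<le> m" "m + 2 \<le> k" for m
      using square_eq[of m] cube_eq[of m] that by simp
    then show ?thesis by (intro Collect_cong) (metis (no_types, lifting))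
  qed
  finally show ?thesis .
qed

lemma P4_eq:
  "P4 k = {shift (k * i) w | w i. 1 \<le> i
    \<and> w \<in> {take (2 * 2 ^ (k - 1) - 1) (return_word k (k - 1)), long_pal k (k - 1), [0, 0]}}"
proof -
  note k_minus_1
  moreover have "{f i a |i. 1 \<le> i} \<union> {f i b |i. 1 \<le> i} \<union> {f i c |i. 1 \<le> i}
      = {f i w |w i. 1 \<le> i \<and> w \<in> {a, b, c}}" for f :: "nat \<Rightarrow> nat list \<Rightarrow> nat list" and a b c
    by auto
  ultimately show ?thesis unfolding P4_def by (simp only: square_eq truncated_cube_eq)
qed

lemma maxpals_Zero_Return:
  "maxpals (run_word k Zero_Return) = insert [0, 0] (maxpals (return_word k (k - 1)))"
proof -
  have alt: "alternating (return_word k (k - 1))" using alternating_return[of "k - 1" k] k by simp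
  have ne: "return_word k (k - 1) \<noteq> []" by (simp add: return_word_def ruler_word_eq_Nil)
  show ?thesis using maxpals_Cons_0(1,2)[OF alt] maxpals_Cons_0(3)[OF alt ne] by auto
qed

lemma maxpals_run_word:
  assumes "good k (i, X)" "w \<in> maxpals (run_word k X)"
  shows "shift (k * i) w \<in> P1 k \<union> P2 k \<union> P3 k \<union> P4 k"
proof -
  have base: "shift (k * i) w \<in> P1 k \<union> P2 k" if "w \<in> zimin_pals k \<union> cut_pals k"
    using that unfolding P1_eq P2_eq by blast
  show ?thesis
  proof (cases X)
    case (Cut l)
    then show ?thesis using maxpals_ruler_word_cut[of l k] assms base by auto
  next
    case (Full m)
    then show ?thesis using maxpals_ruler_word_power[of m k] assms base by auto
  next
    case (Return m)
    then have m: "1 \<le> m" "m + 2 \<le> k" "1 \<le> i" using assms by auto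
    then have "w \<in> zimin_pals k \<union> cut_pals k \<or> w \<in> {take (2 * 2 ^ m - 1) (return_word k m), long_pal k m}"
      using maxpals_return[of m k] assms(2) Return by auto
    then show ?thesis using base m unfolding P3_eq by blast
  next
    case Zero_Full
    then have "w = [0, 0] \<or> w \<in> zimin_pals k"
      using assms(2) maxpals_Cons_0(1)[OF alternating_ruler_word, of "2 ^ (k - 1)"]
        maxpals_ruler_word_power[of "k - 1" k] k by auto
    then show ?thesis using base assms(1) Zero_Full unfolding P4_eq by auto
  next
    case Zero_Return
    then have "w = [0, 0] \<or> w \<in> zimin_pals k \<union> cut_pals k
        \<or> w \<in> {take (2 * 2 ^ (k - 1) - 1) (return_word k (k - 1)), long_pal k (k - 1)}"
      using maxpals_return[OF k_minus_1] assms(2) maxpals_Zero_Return k by auto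
    then show ?thesis using base assms(1) Zero_Return unfolding P4_eq by auto
  qed
qed

text \<open>Few types suffice: \<open>Cut 1\<close> contains all of \<open>P1\<close>,
  \<open>Cut l\<close> the words of \<open>P2\<close> with parameter \<open>l\<close>,
  \<open>Return m\<close> those of \<open>P3\<close>, and \<open>Zero_Return\<close> those of
  \<open>P4\<close>.\<close>

lemma maximal_if_listed:
  assumes "P \<in> P1 k \<union> P2 k \<union> P3 k \<union> P4 k"
  shows "\<exists>a i X. run_at k a i X \<and> P \<in> shift (k * i) ` maxpals (run_word k X)"
proof -
  consider (1) "P \<in> P1 k" | (2) "P \<in> P2 k" | (3) "P \<in> P3 k" | (4) "P \<in> P4 k" using assms by blast
  then show ?thesis
  proof cases
    case 1
    then obtain i w where w: "P = shift (k * i) w" "w \<in> zimin_pals k" unfolding P1_eq by blast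
    obtain a where "run_at k a i (Cut 1)" using run_at_Cut[OF k, of 1 i] k by auto
    moreover have "w \<in> maxpals (run_word k (Cut 1))" using zimin_pals_subset_maxpals w(2) by auto
    ultimately show ?thesis using w(1) by blast
  next
    case 2
    then obtain i j l where w: "P = shift (k * i) (pal_word j (2 ^ j - 2 ^ l))" "1 \<le> l" "l < j" "j < k"
      unfolding P2_eq cut_pals_def by blast
    obtain a where "run_at k a i (Cut l)" using run_at_Cut[OF k, of l i] w by auto
    moreover have "pal_word j (2 ^ j - 2 ^ l) \<in> maxpals (run_word k (Cut l))"
      using cut_pal_in_maxpals w(3,4) by simp
    ultimately show ?thesis using w(1) by blast
  next
    case 3
    then obtain i m w where w: "P = shift (k * i) w" "1 \<le> m" "m + 2 \<le> k" "1 \<le> i"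
      "w \<in> {take (2 * 2 ^ m - 1) (return_word k m), long_pal k m}"
      unfolding P3_eq by blast
    obtain a where "run_at k a i (Return m)" using run_at_Return[OF k w(4,2,3)] by blast
    moreover have "w \<in> maxpals (run_word k (Return m))"
      using return_pals_in_maxpals[of m k] w by auto
    ultimately show ?thesis using w(1) by blast
  next
    case 4
    then obtain i w where w: "P = shift (k * i) w" "1 \<le> i"
      "w \<in> {take (2 * 2 ^ (k - 1) - 1) (return_word k (k - 1)), long_pal k (k - 1), [0, 0]}"
      unfolding P4_eq by blast
    obtain a where "run_at k a i Zero_Return" using run_at_Zero_Return[OF k w(2)] by blast
    moreover have "w \<in> maxpals (run_word k Zero_Return)"
      using return_pals_in_maxpals[OF k_minus_1] w k unfolding maxpals_Zero_Return by auto
    ultimately show ?thesis using w(1) by blast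
  qed
qed

end

theorem theorem6p9:
  fixes k :: nat and P :: "nat list"
  assumes "k \<ge> 3"
    and "is_factor (W_inf k) P"
    and "length P \<ge> 2"
  shows "maximal_palindromic_factor (W_inf k) P \<longleftrightarrow> P \<in> P1 k \<union> P2 k \<union> P3 k \<union> P4 k"
proof
  assume "maximal_palindromic_factor (W_inf k) P"
  then obtain a i X w where "run_at k a i X" "w \<in> maxpals (run_word k X)" "P = shift (k * i) w"
    using maximal_palindromic_factor_runs[OF assms(1)] by blast
  moreover from this have "good k (i, X)" by (simp add: run_at_def)
  ultimately show "P \<in> P1 k \<union> P2 k \<union> P3 k \<union> P4 k"
    using maxpals_run_word[OF assms(1), of i X w] by simp
next
  assume "P \<in> P1 k \<union> P2 k \<union> P3 k \<union> P4 k"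
  then show "maximal_palindromic_factor (W_inf k) P"
    using maximal_if_listed[OF assms(1)] maximal_palindromic_factor_runs[OF assms(1)] by blast
qed

end
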